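(* Let $G$ be a locally precompact group, with completion $\widetilde G$. The following statements are equivalent: (i) $G$ is Dieudonné complete; (ii) $G$ is locally Dieudonné complete; (iii) $G$ is locally realcompact; (iv) $G$ is $G_\delta$-closed in $\widetilde G$; (v) every open subgroup of $G$ is $G_\delta$-closed in $\widetilde G$; (vi) $G$ contains an open subgroup that is $G_\delta$-closed in $\widetilde G$; (vii) every $\omega$-precompact open subgroup of $G$ is realcompact; (viii) $G$ contains a realcompact open subgroup; (ix) $G$ contains a Dieudonné complete open subgroup.
   Context: All topological spaces and topological groups are assumed to be Tychonoff (in particular Hausdorff); groups need not be abelian. "Neighborhood" means open set containing the point; $\mathcal{N}(G)$ is the collection of (open) neighborhoods of the identity of $G$. A subset $X$ of a topological group $G$ is precompact if for every $U\in\mathcal{N}(G)$ there is a finite $S\subseteq X$ with $X\subseteq (SU)\cap(US)$. It is $\omega$-precompact if for every $U\in\mathcal{N}(G)$ there is a countable $S\subseteq X$ with $X\subseteq (SU)\cap(US)$. $G$ is locally precompact if some non-empty open subset of $G$ is precompact; by Weil's theorem, this holds if and only if $G$ embeds as a dense topological subgroup of a locally compact group $\widetilde G$, which is then unique up to topological isomorphism fixing $G$ and is called the completion of $G$ (it coincides with the two-sided, Raĭkov, completion). $G$ is regarded as a subgroup of $\widetilde G$. A $G_\delta$-subset of a space is a countable intersection of open sets; the $G_\delta$-topology is the topology generated by the $G_\delta$-subsets; a subset is $G_\delta$-closed if it is closed in the $G_\delta$-topology. A space is realcompact if it is homeomorphic to a closed subspace of $\mathbb{R}^\lambda$ for some cardinal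 $\lambda$. A space is Dieudonné complete if it is homeomorphic to a closed subspace of a product of metrizable spaces. A space $X$ is locally realcompact (respectively, locally Dieudonné complete) if every $x\in X$ has a neighborhood $U$ such that $\operatorname{cl}_X U$ is realcompact (respectively, Dieudonné complete). *)

theory Defs
  imports "HOL-Analysis.Analysis" "HOL-Algebra.Coset"
begin

section \<open>Topological groups\<close>

text \<open>
  A topology is carried by its own underlying set \<open>topspace\<close>, which has to be the carrier of
  the group. Topological groups are Tychonoff by convention and need not be abelian.
\<close>

locale topological_group = group G for G (structure) +
  fixes T :: "'a topology"
  assumes topspace_eq_carrier: "topspace T = carrier G"
    and continuous_mult: "continuous_map (prod_topology T T) T (\<lambda>(x, y). x \<otimes> y)"
    and continuous_inv: "continuous_map T T (\<lambda>x. inv x)"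
    and Hausdorff: "Hausdorff_space T"
    and completely_regular: "completely_regular_space T"

definition nhds_one :: "('a, 'm) monoid_scheme \<Rightarrow> 'a topology \<Rightarrow> 'a set set" where
  "nhds_one G T = {U. openin T U \<and> \<one>\<^bsub>G\<^esub> \<in> U}"

definition precompact_in :: "('a, 'm) monoid_scheme \<Rightarrow> 'a topology \<Rightarrow> 'a set \<Rightarrow> bool" where
  "precompact_in G T X \<longleftrightarrow> X \<subseteq> carrier G \<and>
     (\<forall>U\<in>nhds_one G T. \<exists>S. finite S \<and> S \<subseteq> X \<and> X \<subseteq> (S <#>\<^bsub>G\<^esub> U) \<inter> (U <#>\<^bsub>G\<^esub> S))"

definition omega_precompact_in :: "('a, 'm) monoid_scheme \<Rightarrow> 'a topology \<Rightarrow> 'a set \<Rightarrow> bool" where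
  "omega_precompact_in G T X \<longleftrightarrow> X \<subseteq> carrier G \<and>
     (\<forall>U\<in>nhds_one G T. \<exists>S. countable S \<and> S \<subseteq> X \<and> X \<subseteq> (S <#>\<^bsub>G\<^esub> U) \<inter> (U <#>\<^bsub>G\<^esub> S))"

definition locally_precompact_group :: "('a, 'm) monoid_scheme \<Rightarrow> 'a topology \<Rightarrow> bool" where
  "locally_precompact_group G T \<longleftrightarrow> topological_group G T \<and>
     (\<exists>V. openin T V \<and> V \<noteq> {} \<and> precompact_in G T V)"

definition open_subgroup :: "('a, 'm) monoid_scheme \<Rightarrow> 'a topology \<Rightarrow> 'a set \<Rightarrow> bool" where
  "open_subgroup G T K \<longleftrightarrow> subgroup K G \<and> openin T K"

text \<open>
  The completion of a locally precompact group is a locally compact group that contains it as a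
  dense topological subgroup. The inclusion is kept as an explicit map \<open>\<iota>\<close>, so that the
  completion may live on another type; a subset \<open>K\<close> of \<open>G\<close>, regarded as a subset of the
  completion, is \<open>\<iota> ` K\<close>.
\<close>

definition group_completion ::
  "('a, 'm) monoid_scheme \<Rightarrow> 'a topology \<Rightarrow> ('b, 'n) monoid_scheme \<Rightarrow> 'b topology \<Rightarrow> ('a \<Rightarrow> 'b) \<Rightarrow> bool"
  where
  "group_completion G T H TH \<iota> \<longleftrightarrow>
     topological_group H TH \<and> locally_compact_space TH \<and>
     \<iota> \<in> hom G H \<and> embedding_map T TH \<iota> \<and> TH closure_of (\<iota> ` carrier G) = carrier H"


section \<open>The $G_\delta$-topology\<close>

definition gdelta_topology :: "'a topology \<Rightarrow> 'a topology" where
  "gdelta_topology X = topology_generated_by {S. gdelta_in X S}"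

abbreviation gdelta_closedin :: "'a topology \<Rightarrow> 'a set \<Rightarrow> bool" where
  "gdelta_closedin X \<equiv> closedin (gdelta_topology X)"


section \<open>Realcompact and Dieudonne complete spaces\<close>

text \<open>
  A definition cannot quantify over all index types (nor over the types of the factors). Below, the
  index set is taken inside a type that depends only on the type of the points of \<open>X\<close>, and in
  the second definition the factors live on that type of points. This is no restriction: by
  \<open>realcompact_spaceI\<close> and \<open>Dieudonne_complete_spaceI\<close> below, a closed embedding into
  a product with arbitrary index type and arbitrary type of factors suffices. (Index a coordinate
  by the function it induces on \<open>X\<close>, and replace each factor by its subspace onto which
  \<open>X\<close> is mapped.)
\<close>

definition realcompact_space :: "'a topology \<Rightarrow> bool" where
  "realcompact_space X \<longleftrightarrow>
     (\<exists>(I :: ('a \<Rightarrow> real) set) S.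
        closedin (product_topology (\<lambda>_. euclideanreal) I) S \<and>
        X homeomorphic_space subtopology (product_topology (\<lambda>_. euclideanreal) I) S)"

definition Dieudonne_complete_space :: "'a topology \<Rightarrow> bool" where
  "Dieudonne_complete_space X \<longleftrightarrow>
     (\<exists>(I :: (('a \<Rightarrow> 'a) \<times> 'a topology) set) (M :: ('a \<Rightarrow> 'a) \<times> 'a topology \<Rightarrow> 'a topology) S.
        (\<forall>i\<in>I. metrizable_space (M i)) \<and>
        closedin (product_topology M I) S \<and>
        X homeomorphic_space subtopology (product_topology M I) S)"

definition locally_realcompact_space :: "'a topology \<Rightarrow> bool" where
  "locally_realcompact_space X \<longleftrightarrow>
     (\<forall>x\<in>topspace X. \<exists>U. openin X U \<and> x \<in> U \<and> realcompact_space (subtopology X (X closure_of U)))"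

definition locally_Dieudonne_complete_space :: "'a topology \<Rightarrow> bool" where
  "locally_Dieudonne_complete_space X \<longleftrightarrow>
     (\<forall>x\<in>topspace X. \<exists>U. openin X U \<and> x \<in> U \<and>
        Dieudonne_complete_space (subtopology X (X closure_of U)))"

lemma closed_embedding_lift:
  assumes h: "homeomorphic_maps X (subtopology Z S) h h'" and S: "closedin Z S"
    and k: "continuous_map X Y k" and g: "continuous_map Y Z g"
    and gk: "\<And>x. x \<in> topspace X \<Longrightarrow> g (k x) = h x"
    and sub: "\<And>u. \<lbrakk>u \<in> topspace Y; g u \<in> S\<rbrakk> \<Longrightarrow> u \<in> k ` topspace X"
  shows "closedin Y (k ` topspace X)" "X homeomorphic_space subtopology Y (k ` topspace X)"
proof -
  have hS: "h x \<in> S" "h' (h x) = x" if "x \<in> topspace X" for x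
    using h that by (auto simp: homeomorphic_maps_def continuous_map_def)
  have kX: "k x \<in> topspace Y" if "x \<in> topspace X" for x
    using k that by (auto simp: continuous_map_def)
  have eq: "k ` topspace X = {u \<in> topspace Y. g u \<in> S}"
    using sub hS kX gk by auto
  show "closedin Y (k ` topspace X)"
    unfolding eq by (rule closedin_continuous_map_preimage[OF g S])
  have "continuous_map (subtopology Y (k ` topspace X)) (subtopology Z S) g"
    using g by (auto simp: continuous_map_in_subtopology eq intro: continuous_map_from_subtopology)
  then have "continuous_map (subtopology Y (k ` topspace X)) X (h' \<circ> g)"
    using h by (auto simp: homeomorphic_maps_def intro: continuous_map_compose)
  then have "homeomorphic_maps X (subtopology Y (k ` topspace X)) k (h' \<circ> g)"
    using k hS gk by (auto simp: homeomorphic_maps_def continuous_map_in_subtopology)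
  then show "X homeomorphic_space subtopology Y (k ` topspace X)"
    by (auto simp: homeomorphic_space_def)
qed

lemma realcompact_spaceI:
  fixes X :: "'a topology" and I :: "'i set"
  assumes S: "closedin (product_topology (\<lambda>_. euclideanreal) I) S"
    and X: "X homeomorphic_space subtopology (product_topology (\<lambda>_. euclideanreal) I) S"
  shows "realcompact_space X"
proof -
  obtain h h' where h: "homeomorphic_maps X (subtopology (product_topology (\<lambda>_. euclideanreal) I) S) h h'"
    using X by (auto simp: homeomorphic_space_def)
  define p where "p = (\<lambda>i x. h x i)"
  define J where "J = p ` I"
  define k where "k = (\<lambda>x. \<lambda>j\<in>J. j x)"
  define g where "g = (\<lambda>u. \<lambda>i\<in>I. u (p i) :: real)"
  have hc: "continuous_map X (product_topology (\<lambda>_. euclideanreal) I) h"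
    using h by (auto simp: homeomorphic_maps_def continuous_map_in_subtopology)
  have hE: "h x \<in> extensional I" if "x \<in> topspace X" for x
    using hc that by (auto simp: continuous_map_componentwise)
  have pc: "continuous_map X euclideanreal (p i)" if "i \<in> I" for i
    using hc that by (simp add: continuous_map_componentwise p_def)
  have k: "continuous_map X (product_topology (\<lambda>_. euclideanreal) J) k"
    using pc by (auto simp: continuous_map_componentwise k_def J_def)
  have g: "continuous_map (product_topology (\<lambda>_. euclideanreal) J) (product_topology (\<lambda>_. euclideanreal) I) g"
    by (auto simp: continuous_map_componentwise g_def J_def intro!: continuous_map_product_projection)
  have gk: "g (k x) = h x" if "x \<in> topspace X" for x
    using hE[OF that] by (auto simp: fun_eq_iff g_def k_def J_def p_def extensional_def)
  have sub: "u \<in> k ` topspace X"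
    if u: "u \<in> topspace (product_topology (\<lambda>_. euclideanreal) J)" and gu: "g u \<in> S" for u
  proof -
    have "g u \<in> topspace (subtopology (product_topology (\<lambda>_. euclideanreal) I) S)"
      using gu closedin_subset[OF S] by auto
    then have "h' (g u) \<in> topspace X" "h (h' (g u)) = g u"
      using h unfolding homeomorphic_maps_def continuous_map_def by blast+
    then obtain x where x: "x \<in> topspace X" "h x = g u"
      by blast
    have "u (p i) = p i x" if "i \<in> I" for i
      using x(2) that by (auto simp: g_def p_def)
    then have "u = k x"
      using u by (auto simp: fun_eq_iff k_def J_def extensional_def PiE_def)
    then show ?thesis using x by blast
  qed
  show ?thesis
    unfolding realcompact_space_def
    using closed_embedding_lift[OF h S k g gk sub] by blast
qed

lemma Dieudonne_complete_spaceI: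
  fixes X :: "'a topology" and I :: "'i set" and M :: "'i \<Rightarrow> 'b topology"
  assumes M: "\<And>i. i \<in> I \<Longrightarrow> metrizable_space (M i)"
    and S: "closedin (product_topology M I) S"
    and X: "X homeomorphic_space subtopology (product_topology M I) S"
  shows "Dieudonne_complete_space X"
proof -
  obtain h h' where h: "homeomorphic_maps X (subtopology (product_topology M I) S) h h'"
    using X by (auto simp: homeomorphic_space_def)
  define p where "p = (\<lambda>i x. h x i)"
  define r where "r = (\<lambda>i x. SOME y. y \<in> topspace X \<and> p i y = p i x)"
  define N where "N = (\<lambda>i. pullback_topology (r i ` topspace X) (p i) (M i))"
  define J where "J = (\<lambda>i. (r i, N i)) ` I"
  define k where "k = (\<lambda>x. \<lambda>j\<in>J. fst j x)"
  define g where "g = (\<lambda>u. \<lambda>i\<in>I. p i (u (r i, N i)))"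
  have hc: "continuous_map X (product_topology M I) h"
    using h by (auto simp: homeomorphic_maps_def continuous_map_in_subtopology)
  have hE: "h x \<in> extensional I" if "x \<in> topspace X" for x
    using hc that by (auto simp: continuous_map_componentwise)
  have pc: "continuous_map X (M i) (p i)" if "i \<in> I" for i
    using hc that by (simp add: continuous_map_componentwise p_def)
  have r: "r i x \<in> topspace X" "p i (r i x) = p i x" if "x \<in> topspace X" for i x
    using someI[of "\<lambda>y. y \<in> topspace X \<and> p i y = p i x" x] that by (auto simp: r_def)
  have r_eq: "r i x = r i y" if "p i x = p i y" for i x y
    using that by (simp add: r_def)
  have inj: "a = b" if "a \<in> r i ` topspace X" "b \<in> r i ` topspace X" "p i a = p i b" for i a b
  proof -
    obtain x y where xy: "x \<in> topspace X" "a = r i x" "y \<in> topspace X" "b = r i y"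
      using \<open>a \<in> r i ` topspace X\<close> \<open>b \<in> r i ` topspace X\<close> by blast
    then have "p i x = p i y"
      using \<open>p i a = p i b\<close> r(2)[of x i] r(2)[of y i] by simp
    then show ?thesis using xy r_eq[of i x y] by simp
  qed
  have pM: "p i x \<in> topspace (M i)" if "i \<in> I" "x \<in> topspace X" for i x
    using pc[OF that(1)] that(2) by (auto simp: continuous_map_def)
  have topN: "topspace (N i) = r i ` topspace X" if "i \<in> I" for i
    using pM[OF that] r by (auto simp: N_def topspace_pullback_topology)
  have pN: "continuous_map (N i) (M i) (p i)" for i
    unfolding N_def using continuous_map_pullback[of "M i" "M i" id] by simp
  have rN: "continuous_map X (N i) (r i)" if "i \<in> I" for i
    unfolding N_def
  proof (rule continuous_map_pullback')
    show "continuous_map X (M i) (p i \<circ> r i)"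
      by (rule continuous_map_eq[OF pc[OF that]]) (use r in auto)
  qed auto
  have metN: "metrizable_space (N i)" if i: "i \<in> I" for i
  proof -
    define P where "P = p i ` topspace (N i)"
    define q where "q = inv_into (topspace (N i)) (p i)"
    have inj': "inj_on (p i) (topspace (N i))"
      using inj by (auto simp: inj_on_def topN[OF i])
    have "continuous_map (subtopology (M i) P) (N i) q"
      unfolding N_def
    proof (rule continuous_map_pullback')
      show "continuous_map (subtopology (M i) P) (M i) (p i \<circ> q)"
        by (rule continuous_map_eq[of _ _ id])
           (auto simp: P_def q_def f_inv_into_f intro: continuous_map_from_subtopology)
    next
      show "topspace (subtopology (M i) P) \<subseteq> q -` (r i ` topspace X)"
        by (auto simp: P_def q_def simp flip: topN[OF i] intro: inv_into_into)
    qed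
    then have "homeomorphic_maps (N i) (subtopology (M i) P) (p i) q"
      using pN inj' by (auto simp: homeomorphic_maps_def continuous_map_in_subtopology P_def q_def f_inv_into_f)
    then have "N i homeomorphic_space subtopology (M i) P"
      by (auto simp: homeomorphic_space_def)
    then show ?thesis
      using homeomorphic_metrizable_space metrizable_space_subtopology[OF M[OF i]] by blast
  qed
  have metJ: "\<forall>j\<in>J. metrizable_space (snd j)"
    using metN by (auto simp: J_def)
  have k: "continuous_map X (product_topology snd J) k"
    using rN by (auto simp: continuous_map_componentwise k_def J_def)
  have g: "continuous_map (product_topology snd J) (product_topology M I) g"
  proof -
    have "continuous_map (product_topology snd J) (M i) (\<lambda>u. p i (u (r i, N i)))" if "i \<in> I" for i
    proof -
      have "continuous_map (product_topology snd J) (snd (r i, N i)) (\<lambda>u. u (r i, N i))"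
        by (rule continuous_map_product_projection) (use that in \<open>auto simp: J_def\<close>)
      then show ?thesis
        using continuous_map_compose[OF _ pN] by (force simp: o_def)
    qed
    then show ?thesis
      by (auto simp: continuous_map_componentwise g_def)
  qed
  have gk: "g (k x) = h x" if "x \<in> topspace X" for x
  proof
    fix i
    show "g (k x) i = h x i"
      using hE[OF that] r(2)[OF that]
      by (cases "i \<in> I") (auto simp: g_def k_def J_def p_def extensional_def)
  qed
  have sub: "u \<in> k ` topspace X"
    if u: "u \<in> topspace (product_topology snd J)" and gu: "g u \<in> S" for u
  proof -
    have "g u \<in> topspace (subtopology (product_topology M I) S)"
      using gu closedin_subset[OF S] by auto
    then have "h' (g u) \<in> topspace X" "h (h' (g u)) = g u"
      using h unfolding homeomorphic_maps_def continuous_map_def by blast+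
    then obtain x where x: "x \<in> topspace X" "h x = g u"
      by blast
    have "u (r i, N i) = r i x" if i: "i \<in> I" for i
    proof (rule inj)
      show "u (r i, N i) \<in> r i ` topspace X"
        using u i topN[OF i] by (force simp: J_def PiE_def Pi_def)
      show "r i x \<in> r i ` topspace X" using x by blast
      show "p i (u (r i, N i)) = p i (r i x)"
        using x(2) i r(2)[OF x(1)] by (simp add: g_def p_def)
    qed
    then have "u = k x"
      using u by (auto simp: fun_eq_iff k_def J_def extensional_def PiE_def)
    then show ?thesis using x by blast
  qed
  show ?thesis
    unfolding Dieudonne_complete_space_def
    using metJ closed_embedding_lift[OF h S k g gk sub] by blast
qed

end

(*
  Three facts about a dense subgroup A of a locally compact group H drive the equivalences.

  (1) A continuous map from A, or from its trace on an open set, to a metric space has a limit at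
  every point x of the G-delta closure of A. Any disjoint family of open subsets of a compact set is
  countable: cover the compact set by translates of a small U and count those that meet each member.
  Take a maximal disjoint family of open sets on whose traces f oscillates little and which are
  unions of left cosets of G-delta subgroups. The intersection N of these countably many subgroups
  is a G-delta set, so A meets xN, and the small oscillation of f at a point of A in xN is carried
  over to x by right translation with an element of N.
  Hence, if a neighborhood of the identity in A is Dieudonne complete, its closed embedding into a
  product of metrizable spaces extends to x, so that x belongs to A: the subgroup A is G-delta
  closed.

  (2) A G-delta closed subset K of a compact Hausdorff space Z is realcompact: K is the set where
  certain continuous functions f on Z do not vanish, and the coordinates f and 1/f embed it as a
  closed subspace. A sigma-compact open subset of H reduces to this case through its one-point
  compactification, in which the point at infinity is a G-delta set.

  (3) H has a sigma-compact open subgroup L, and a G-delta closed A is homeomorphic to the product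
  of the realcompact space given by A and L with a discrete space of coset representatives.
*)
theory Submission
  imports Defs
begin

section \<open>The $G_\delta$-topology, realcompactness and Dieudonne completeness\<close>

text \<open>Finite intersections of G-delta sets are again G-delta, so these sets form a base of the
  topology that they generate: openness can be tested by a single G-delta set around each
  point.\<close>

lemma openin_gdelta_topology:
  "openin (gdelta_topology X) S \<longleftrightarrow> (\<forall>x\<in>S. \<exists>Q. gdelta_in X Q \<and> x \<in> Q \<and> Q \<subseteq> S)"
proof
  assume "openin (gdelta_topology X) S"
  then have "generate_topology_on {S. gdelta_in X S} S"
    by (simp add: gdelta_topology_def openin_topology_generated_by)
  then show "\<forall>x\<in>S. \<exists>Q. gdelta_in X Q \<and> x \<in> Q \<and> Q \<subseteq> S"
  proof induction
    case (Int a b)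
    show ?case
    proof
      fix x assume "x \<in> a \<inter> b"
      with Int obtain P Q where "gdelta_in X P" "x \<in> P" "P \<subseteq> a" "gdelta_in X Q" "x \<in> Q" "Q \<subseteq> b"
        by (meson IntE)
      then show "\<exists>Q. gdelta_in X Q \<and> x \<in> Q \<and> Q \<subseteq> a \<inter> b"
        by (intro exI[of _ "P \<inter> Q"]) (auto intro: gdelta_in_Int)
    qed
  next
    case (UN K)
    then show ?case by (meson Union_iff Union_upper order_trans)
  qed auto
next
  assume R: "\<forall>x\<in>S. \<exists>Q. gdelta_in X Q \<and> x \<in> Q \<and> Q \<subseteq> S"
  have "\<exists>T. openin (gdelta_topology X) T \<and> x \<in> T \<and> T \<subseteq> S" if "x \<in> S" for x
    using R that unfolding gdelta_topology_def
    by (meson mem_Collect_eq topology_generated_by_Basis)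
  then show "openin (gdelta_topology X) S"
    by (subst openin_subopen) blast
qed

lemma topspace_gdelta_topology [simp]: "topspace (gdelta_topology X) = topspace X"
  using gdelta_in_subset by (fastforce simp: gdelta_topology_def)

lemma gdelta_closedin_iff:
  "gdelta_closedin X S \<longleftrightarrow>
     S \<subseteq> topspace X \<and> (\<forall>x\<in>topspace X - S. \<exists>Q. gdelta_in X Q \<and> x \<in> Q \<and> Q \<inter> S = {})"
proof -
  have "Q \<subseteq> topspace X - S \<longleftrightarrow> Q \<inter> S = {}" if "gdelta_in X Q" for Q
    using gdelta_in_subset[OF that] by blast
  then show ?thesis
    unfolding closedin_def openin_gdelta_topology
    by (simp add: conj_commute cong: conj_cong)
qed

lemma closedin_imp_gdelta_closedin: "closedin X S \<Longrightarrow> gdelta_closedin X S"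
  unfolding gdelta_closedin_iff
  by (metis Diff_disjoint closedin_def inf_commute open_imp_gdelta_in)

lemma gdelta_in_continuous_map_preimage:
  assumes "continuous_map X Y f" "gdelta_in Y Q"
  shows "gdelta_in X {x \<in> topspace X. f x \<in> Q}"
proof -
  obtain C where C: "\<And>n::nat. openin Y (C n)" "\<Inter>(range C) = Q"
    using assms(2) by (auto simp: gdelta_in_descending)
  have "{x \<in> topspace X. f x \<in> Q} = \<Inter>(range (\<lambda>n. {x \<in> topspace X. f x \<in> C n}))"
    using C by auto
  moreover have "gdelta_in X \<dots>"
    using C openin_continuous_map_preimage[OF assms(1)]
    by (intro gdelta_in_Inter) (auto intro: open_imp_gdelta_in)
  ultimately show ?thesis by simp
qed

lemma continuous_map_gdelta_topology:
  assumes "continuous_map X Y f"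
  shows "continuous_map (gdelta_topology X) (gdelta_topology Y) f"
  unfolding continuous_map_def
proof (intro conjI allI impI)
  show "f \<in> topspace (gdelta_topology X) \<rightarrow> topspace (gdelta_topology Y)"
    using assms by (simp add: continuous_map_def)
  fix U assume "openin (gdelta_topology Y) U"
  then show "openin (gdelta_topology X) {x \<in> topspace (gdelta_topology X). f x \<in> U}"
    unfolding openin_gdelta_topology
    using gdelta_in_continuous_map_preimage[OF assms] by (fastforce simp: subset_iff)
qed

text \<open>Each of the countably many open sets that cut out \<open>Q\<close> has a function that
  vanishes at \<open>z\<close> and equals 1 outside it. The sum with weights \<open>(1/2)^n\<close>
  vanishes at \<open>z\<close> and is positive wherever some summand is, hence everywhere outside
  \<open>Q\<close>.\<close>

lemma gdelta_point_separation:
  assumes Z: "completely_regular_space Z" and Q: "gdelta_in Z Q" "z \<in> Q"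
  shows "\<exists>f. continuous_map Z euclideanreal f \<and> f z = 0 \<and> (\<forall>y\<in>topspace Z - Q. f y > 0)"
proof -
  obtain C where C: "\<And>n::nat. openin Z (C n)" "\<Inter>(range C) = Q"
    using Q(1) by (auto simp: gdelta_in_descending)
  have "\<exists>f::'a\<Rightarrow>real. continuous_map Z (top_of_set {0..1}) f \<and> f z = 0 \<and> f ` (topspace Z - C n) \<subseteq> {1}" for n
  proof -
    have "closedin Z (topspace Z - C n)" "z \<in> topspace Z - (topspace Z - C n)"
      using C Q openin_subset[OF C(1)] by auto
    then show ?thesis using Z unfolding completely_regular_space_def by blast
  qed
  then obtain f :: "nat \<Rightarrow> 'a \<Rightarrow> real"
    where f: "\<And>n. continuous_map Z (top_of_set {0..1}) (f n)" "\<And>n. f n z = 0"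
      "\<And>n y. y \<in> topspace Z \<Longrightarrow> y \<notin> C n \<Longrightarrow> f n y = 1"
    by (metis DiffI image_subset_iff singletonD)
  have fr: "0 \<le> f n y" "f n y \<le> 1" if "y \<in> topspace Z" for n y
    using f(1)[of n] that by (auto simp: continuous_map_in_subtopology)
  have fc: "continuous_map Z euclideanreal (f n)" for n
    using f(1)[of n] by (auto simp: continuous_map_in_subtopology)
  define g where "g = (\<lambda>y. \<Sum>n. f n y * (1/2)^n)"
  have sm: "summable (\<lambda>n. f n y * (1/2)^n)" if "y \<in> topspace Z" for y
    by (rule summable_comparison_test'[where g="\<lambda>n. (1/2)^n" and N=0])
       (use fr[OF that] in \<open>auto simp: mult_le_cancel_right1 abs_mult\<close>)
  \<comment> \<open>The bound is a geometric tail and does not depend on \<open>y\<close>. The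
    partial sums therefore converge uniformly, and \<open>g\<close> is continuous.\<close>
  have tail: "\<bar>(\<Sum>k<n. f k y * (1/2)^k) - g y\<bar> \<le> 2 * (1/2)^n" if y: "y \<in> topspace Z" for n y
  proof -
    have s: "summable (\<lambda>k. f (k+n) y * (1/2)^(k+n))"
      using sm[OF y] by (subst summable_iff_shift)
    have "g y - (\<Sum>k<n. f k y * (1/2)^k) = (\<Sum>k. f (k+n) y * (1/2)^(k+n))"
      unfolding g_def using suminf_minus_initial_segment[OF sm[OF y], of n] by simp
    moreover have "(\<Sum>k. f (k+n) y * (1/2)^(k+n)) \<le> (\<Sum>k. (1/2)^n * (1/2)^k)"
      by (rule suminf_le[OF _ s])
         (use fr[OF y] in \<open>auto simp: power_add mult_le_cancel_right1 mult.commute[of "(1/2)^n"] intro!: summable_mult2\<close>)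
    moreover have "(\<Sum>k. (1/2)^n * (1/2::real)^k) = 2 * (1/2)^n"
      by (subst suminf_mult) (auto simp: suminf_geometric)
    moreover have "0 \<le> (\<Sum>k. f (k+n) y * (1/2)^(k+n))"
      by (rule suminf_nonneg[OF s]) (use fr[OF y] in auto)
    ultimately show ?thesis by simp
  qed
  have "continuous_map Z Met_TC.mtopology g"
  proof (rule Met_TC.continuous_map_uniform_limit[where F=sequentially and f="\<lambda>n y. \<Sum>k<n. f k y * (1/2)^k"])
    show "\<forall>\<^sub>F n in sequentially. continuous_map Z Met_TC.mtopology (\<lambda>y. \<Sum>k<n. f k y * (1/2)^k)"
      using fc by (auto intro!: continuous_map_sum continuous_map_real_mult always_eventually)
  next
    fix e :: real assume "e > 0"
    have "(\<lambda>n. 2 * (1/2::real)^n) \<longlonglongrightarrow> 2 * 0"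
      by (intro tendsto_intros LIMSEQ_realpow_zero) auto
    then have "\<forall>\<^sub>F n in sequentially. 2 * (1/2::real)^n < e"
      using order_tendstoD(2) \<open>e > 0\<close> by fastforce
    then show "\<forall>\<^sub>F n in sequentially. \<forall>y\<in>topspace Z. g y \<in> UNIV \<and> dist (\<Sum>k<n. f k y * (1/2)^k) (g y) < e"
      by eventually_elim (use tail in \<open>auto simp: dist_real_def intro: order.strict_trans1\<close>)
  qed simp
  then have "continuous_map Z euclideanreal g" by simp
  moreover have "g z = 0" by (simp add: g_def f)
  moreover have "g y > 0" if y: "y \<in> topspace Z - Q" for y
  proof -
    obtain n where "y \<notin> C n" using y C by auto
    then have "f n y * (1/2)^n > 0" using f(3) y by simp
    then show ?thesis unfolding g_def
      by (subst suminf_pos_iff) (use sm y fr in auto)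
  qed
  ultimately show ?thesis by blast
qed

section \<open>Invariance and products of complete spaces\<close>

lemma realcompact_space_homeomorphic:
  assumes "realcompact_space X" "X homeomorphic_space Y"
  shows "realcompact_space Y"
proof -
  obtain I :: "('a \<Rightarrow> real) set" and S where S: "closedin (product_topology (\<lambda>_. euclideanreal) I) S"
    and h: "X homeomorphic_space subtopology (product_topology (\<lambda>_. euclideanreal) I) S"
    using assms(1) unfolding realcompact_space_def by blast
  have "Y homeomorphic_space subtopology (product_topology (\<lambda>_. euclideanreal) I) S"
    using assms(2) h homeomorphic_space_sym homeomorphic_space_trans by blast
  then show ?thesis
    by (rule realcompact_spaceI[OF S])
qed

lemma Dieudonne_complete_space_homeomorphic:
  assumes "Dieudonne_complete_space X" "X homeomorphic_space Y"
  shows "Dieudonne_complete_space Y"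
proof -
  obtain I and M :: "('a \<Rightarrow> 'a) \<times> 'a topology \<Rightarrow> 'a topology" and S where M: "\<And>i. i\<in>I \<Longrightarrow> metrizable_space (M i)"
    and S: "closedin (product_topology M I) S" and h: "X homeomorphic_space subtopology (product_topology M I) S"
    using assms(1) unfolding Dieudonne_complete_space_def by blast
  have "Y homeomorphic_space subtopology (product_topology M I) S"
    using assms(2) h homeomorphic_space_sym homeomorphic_space_trans by blast
  with M S show ?thesis
    by (rule Dieudonne_complete_spaceI)
qed

lemma realcompact_imp_Dieudonne_complete_space:
  "realcompact_space X \<Longrightarrow> Dieudonne_complete_space X"
proof -
  assume "realcompact_space X"
  then obtain I :: "('a \<Rightarrow> real) set" and S where S: "closedin (product_topology (\<lambda>_. euclideanreal) I) S"
    and h: "X homeomorphic_space subtopology (product_topology (\<lambda>_. euclideanreal) I) S"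
    unfolding realcompact_space_def by blast
  show ?thesis
    by (rule Dieudonne_complete_spaceI[OF _ S h]) (rule metrizable_space_euclidean)
qed

text \<open>A coordinate \<open>None\<close> adjoins the factor \<open>Y\<close> to a product in
  which \<open>X\<close> is closed. The two spaces share a point type because the factors of one
  product do. Below, \<open>X\<close> is the trace of a group on an open subgroup and
  \<open>Y\<close> a discrete set of coset representatives.\<close>

lemma Dieudonne_complete_space_prod_metrizable:
  fixes X Y :: "'a topology"
  assumes "Dieudonne_complete_space X" "metrizable_space Y"
  shows "Dieudonne_complete_space (prod_topology X Y)"
proof -
  obtain I and M :: "('a \<Rightarrow> 'a) \<times> 'a topology \<Rightarrow> 'a topology" and S
    where M: "\<And>i. i\<in>I \<Longrightarrow> metrizable_space (M i)"
    and S: "closedin (product_topology M I) S" and h: "X homeomorphic_space subtopology (product_topology M I) S"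
    using assms(1) unfolding Dieudonne_complete_space_def by blast
  define J where "J = insert None (Some ` I)"
  define N where "N = case_option Y M"
  define P where "P = product_topology N J"
  define r where "r = (\<lambda>u. (\<lambda>i\<in>I. u (Some i)) :: _ \<Rightarrow> 'a)"
  have r: "continuous_map P (product_topology M I) r"
    unfolding r_def continuous_map_componentwise P_def
  proof (intro conjI ballI)
    fix i assume "i \<in> I"
    then show "continuous_map (product_topology N J) (M i) (\<lambda>x. (\<lambda>i\<in>I. x (Some i)) i)"
      using continuous_map_product_projection[of "Some i" J N] by (simp add: N_def J_def)
  qed auto
  have n: "continuous_map P Y (\<lambda>u. u None)"
    using continuous_map_product_projection[of None J N] by (simp add: P_def N_def J_def)
  \<comment> \<open>The closed condition constrains only the old coordinates; the coordinate
    \<open>None\<close> ranges freely over \<open>Y\<close>.\<close>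
  define T where "T = {u \<in> topspace P. r u \<in> S}"
  have T: "closedin P T"
    unfolding T_def by (rule closedin_continuous_map_preimage[OF r S])
  define Q where "Q = prod_topology (subtopology (product_topology M I) S) Y"
  define e where "e = (\<lambda>(u, y). \<lambda>j\<in>J. case j of None \<Rightarrow> y | Some i \<Rightarrow> (u i :: 'a))"
  have ec: "continuous_map Q P e"
    unfolding P_def continuous_map_componentwise
  proof (intro conjI ballI)
    show "e ` topspace Q \<subseteq> extensional J" by (auto simp: e_def)
    fix j assume j: "j \<in> J"
    have f: "continuous_map Q (product_topology M I) fst" "continuous_map Q Y snd"
      using continuous_map_fst[of "subtopology (product_topology M I) S" Y]
        continuous_map_snd[of "subtopology (product_topology M I) S" Y]
      by (auto simp: Q_def continuous_map_in_subtopology)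
    show "continuous_map Q (N j) (\<lambda>x. e x j)"
    proof (cases j)
      case None then show ?thesis using f j by (simp add: e_def N_def case_prod_beta)
    next
      case (Some i)
      then have "continuous_map Q (M i) (\<lambda>x. fst x i)"
        using continuous_map_compose[OF f(1) continuous_map_product_projection[of i I M]] j
        by (auto simp: o_def J_def)
      then show ?thesis using Some j by (simp add: e_def N_def case_prod_beta)
    qed
  qed
  have re: "r (e (u,y)) = u" if "u \<in> S" for u y
  proof -
    have "u \<in> extensional I" using closedin_subset[OF S] that by (auto simp: PiE_def)
    then show ?thesis by (auto simp: r_def e_def J_def extensional_def fun_eq_iff)
  qed
  have "homeomorphic_maps Q (subtopology P T) e (\<lambda>u. (r u, u None))"
    unfolding homeomorphic_maps_def
  proof (intro conjI ballI)
    show "continuous_map Q (subtopology P T) e"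
    proof -
      have "e ` topspace Q \<subseteq> T"
        using re continuous_map_image_subset_topspace[OF ec] by (auto simp: T_def Q_def)
      then show ?thesis using ec by (auto simp: continuous_map_in_subtopology)
    qed
    show "continuous_map (subtopology P T) Q (\<lambda>u. (r u, u None))"
      using r n by (auto simp: Q_def continuous_map_paired continuous_map_in_subtopology T_def 
        intro: continuous_map_from_subtopology)
    show "(r (e x), e x None) = x" if "x \<in> topspace Q" for x
      using that re by (auto simp: Q_def e_def J_def)
    show "e (r u, u None) = u" if "u \<in> topspace (subtopology P T)" for u
      using that by (auto simp: e_def r_def J_def P_def fun_eq_iff PiE_def extensional_def split: option.split)
  qed
  then have "Q homeomorphic_space subtopology P T" by (auto simp: homeomorphic_space_def)
  moreover have "prod_topology X Y homeomorphic_space Q"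
    unfolding Q_def using h by (intro homeomorphic_space_prod_topology) auto
  ultimately have "prod_topology X Y homeomorphic_space subtopology (product_topology N J) T"
    using homeomorphic_space_trans P_def by blast
  moreover have "\<And>j. j \<in> J \<Longrightarrow> metrizable_space (N j)"
    using M assms(2) by (auto simp: J_def N_def)
  ultimately show ?thesis
    using T unfolding P_def by (intro Dieudonne_complete_spaceI)
qed

text \<open>All continuous real functions together embed \<open>Z\<close> as a closed set. Adding
  \<open>1 / f\<close> for every \<open>f\<close> without zeros on \<open>K\<close> keeps the image
  of \<open>K\<close> closed: a point outside \<open>K\<close> is a zero of some such
  \<open>f\<close>, and there the reciprocal has no possible value.\<close>

lemma realcompact_space_gdelta_closed_in_compact:
  assumes Z: "compact_space Z" "Hausdorff_space Z" and K: "gdelta_closedin Z K"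
  shows "realcompact_space (subtopology Z K)"
proof -
  have cr: "completely_regular_space Z"
    using Z compact_Hausdorff_or_regular_imp_normal_space normal_imp_completely_regular_space by blast
  have KZ: "K \<subseteq> topspace Z" using K by (auto simp: gdelta_closedin_iff)
  define C where "C = {f. continuous_map Z euclideanreal f}"
  define RC where "RC = product_topology (\<lambda>_. euclideanreal) C"
  define L where "L = {f \<in> C. \<forall>y\<in>K. f y \<noteq> 0}"
  \<comment> \<open>A coordinate \<open>Inl f\<close> carries the value of \<open>f\<close>, a
    coordinate \<open>Inr f\<close> its reciprocal.\<close>
  define J where "J = Inl ` C \<union> Inr ` L"
  define RJ where "RJ = product_topology (\<lambda>_. euclideanreal) J"
  define e where "e = (\<lambda>z. \<lambda>f\<in>C. f z :: real)"
  have ec: "continuous_map Z RC e"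
    unfolding RC_def RJ_def by (auto simp: continuous_map_componentwise e_def C_def)
  have inj: "inj_on e (topspace Z)"
  proof (rule inj_onI, rule ccontr)
    fix x y assume xy: "x \<in> topspace Z" "y \<in> topspace Z" "e x = e y" "x \<noteq> y"
    have "closedin Z {y}" using Z xy by (simp add: closedin_Hausdorff_singleton)
    then obtain f where "continuous_map Z euclideanreal f" "f x = 0" "f y = 1"
      using cr xy unfolding completely_regular_space_alt by (metis DiffI empty_iff image_subset_iff insert_iff)
    then show False using xy by (metis (mono_tags, lifting) C_def e_def mem_Collect_eq restrict_apply' zero_neq_one)
  qed
  have HR: "Hausdorff_space RC"
    by (simp add: RC_def Hausdorff_space_product_topology)
  have emb: "embedding_map Z RC e"
    using Z ec inj HR continuous_imp_closed_map injective_closed_imp_embedding_map by metis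
  then obtain e' where e': "homeomorphic_maps Z (subtopology RC (e ` topspace Z)) e e'"
    by (auto simp: embedding_map_def homeomorphic_map_maps)
  have eZ: "closedin RC (e ` topspace Z)"
    using Z ec HR by (meson compactin_imp_closedin image_compactin compact_space_def)
  define p where "p = (\<lambda>u. \<lambda>f\<in>C. u (Inl f :: ('a\<Rightarrow>real) + ('a\<Rightarrow>real)) :: real)"
  have pc: "continuous_map RJ RC p"
    unfolding RC_def RJ_def by (auto simp: continuous_map_componentwise p_def J_def intro!: continuous_map_product_projection)
  \<comment> \<open>The equation with right-hand side 1 is a closed condition that says at once that
    \<open>f\<close> does not vanish and that the second coordinate is its reciprocal.\<close>
  define S where "S = {u \<in> topspace RJ. p u \<in> e ` topspace Z} \<inter> {u \<in> topspace RJ. \<forall>f\<in>L. u (Inl f) * u (Inr f) \<in> {1}}"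
  have L1: "closedin RJ {u \<in> topspace RJ. u (Inl f) * u (Inr f) \<in> {1}}" if "f \<in> L" for f
    using that 
    by (intro closedin_continuous_map_preimage[where Y=euclideanreal])
       (auto simp: RC_def RJ_def J_def L_def intro!: continuous_map_real_mult continuous_map_product_projection)
  have "closedin RJ {u \<in> topspace RJ. \<forall>f\<in>L. u (Inl f) * u (Inr f) \<in> {1}}"
  \<comment> \<open>An empty intersection would be the whole type instead of the
    \<open>topspace\<close>, so this case is split off.\<close>
  proof (cases "L = {}")
    case False
    have eq: "{u \<in> topspace RJ. \<forall>f\<in>L. u (Inl f) * u (Inr f) \<in> {1}}
        = (\<Inter>f\<in>L. {u \<in> topspace RJ. u (Inl f) * u (Inr f) \<in> {1}})"
      using False by auto
    show ?thesis
      unfolding eq by (intro closedin_INT False L1)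
  qed auto
  then have S: "closedin RJ S"
    unfolding S_def using closedin_continuous_map_preimage[OF pc eZ] by blast
  define k where "k = (\<lambda>z. \<lambda>j\<in>J. case j of Inl f \<Rightarrow> f z | Inr f \<Rightarrow> 1 / f z)"
  have kc: "continuous_map (subtopology Z K) RJ k"
    unfolding RC_def RJ_def continuous_map_componentwise
  proof (intro conjI ballI)
    fix j assume j: "j \<in> J"
    then consider f where "f \<in> C" "j = Inl f" | f where "f \<in> L" "j = Inr f"
      by (auto simp: J_def)
    then show "continuous_map (subtopology Z K) euclideanreal (\<lambda>x. k x j)"
    proof cases
      case 1
      then show ?thesis using j by (simp add: k_def C_def continuous_map_from_subtopology)
    next
      case 2
      then have "continuous_map (subtopology Z K) euclideanreal (\<lambda>x. 1 / f x)"
        by (intro continuous_map_real_divide continuous_map_from_subtopology) (auto simp: L_def C_def)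
      then show ?thesis using 2 j by (simp add: k_def)
    qed
  qed (auto simp: k_def)
  have pk: "p (k z) = e z" for z
    by (auto simp: p_def k_def e_def J_def)
  have kS: "k z \<in> S" if "z \<in> K" for z
  proof -
    have "k z \<in> topspace RJ" using kc that KZ by (auto simp: continuous_map_def)
    moreover have "k z (Inl f) * k z (Inr f) = 1" if "f \<in> L" for f
      using that \<open>z \<in> K\<close> by (auto simp: k_def J_def L_def)
    ultimately show ?thesis using pk that KZ by (auto simp: S_def)
  qed
  have SK: "e' (p u) \<in> K \<and> k (e' (p u)) = u" if u: "u \<in> S" for u
  proof -
    obtain z where z: "z \<in> topspace Z" "p u = e z" using u by (auto simp: S_def)
    have e'z: "e' (p u) = z" using z e' by (auto simp: homeomorphic_maps_def)
    have ui: "u (Inl f) = f z" if "f \<in> C" for f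
      using z(2) that by (metis e_def p_def restrict_apply')
    have uL: "f z * u (Inr f) = 1" if "f \<in> L" for f
      using u ui[of f] that by (auto simp: S_def L_def)
    \<comment> \<open>Otherwise a G-delta set around \<open>z\<close> that misses \<open>K\<close>
      yields a function in \<open>L\<close> that vanishes at \<open>z\<close>, against
      \<open>uL\<close>.\<close>
    have zK: "z \<in> K"
    proof (rule ccontr)
      assume "z \<notin> K"
      then obtain Q where Q: "gdelta_in Z Q" "z \<in> Q" "Q \<inter> K = {}"
        using K z unfolding gdelta_closedin_iff by blast
      then obtain f where "continuous_map Z euclideanreal f" "f z = 0" "\<forall>y\<in>topspace Z - Q. f y > 0"
        using gdelta_point_separation[OF cr] by blast
      then have "f \<in> L" "f z = 0" using KZ Q by (auto simp: L_def C_def) force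
      then show False using uL by fastforce
    qed
    have uE: "u \<in> extensional J" using u by (auto simp: S_def RC_def RJ_def PiE_def)
    have "u j = k z j" for j
    proof (cases "j \<in> J")
      case True
      then consider f where "f \<in> C" "j = Inl f" | f where "f \<in> L" "j = Inr f"
        by (auto simp: J_def)
      then show ?thesis
      proof cases
        case 1 then show ?thesis using ui True by (simp add: k_def)
      next
        case 2 
        then have "f z \<noteq> 0" using zK by (auto simp: L_def)
        then show ?thesis using uL[OF 2(1)] True 2 by (simp add: k_def field_simps)
      qed
    next
      case False then show ?thesis using uE by (auto simp: k_def extensional_def)
    qed
    then show ?thesis using zK e'z by auto
  qed
  have "homeomorphic_maps (subtopology Z K) (subtopology RJ S) k (e' \<circ> p)"
    unfolding homeomorphic_maps_def
  proof (intro conjI ballI)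
    show "continuous_map (subtopology Z K) (subtopology RJ S) k"
      using kc kS by (auto simp: continuous_map_in_subtopology)
    have "continuous_map (subtopology RJ S) (subtopology RC (e ` topspace Z)) p"
      using pc by (auto simp: continuous_map_in_subtopology S_def intro: continuous_map_from_subtopology)
    then have "continuous_map (subtopology RJ S) Z (e' \<circ> p)"
      using e' by (auto simp: homeomorphic_maps_def intro: continuous_map_compose)
    then show "continuous_map (subtopology RJ S) (subtopology Z K) (e' \<circ> p)"
      using SK by (auto simp: continuous_map_in_subtopology)
    show "(e' \<circ> p) (k x) = x" if "x \<in> topspace (subtopology Z K)" for x
      using that e' by (auto simp: pk homeomorphic_maps_def)
    show "k ((e' \<circ> p) u) = u" if "u \<in> topspace (subtopology RJ S)" for u
      using that SK by auto
  qed
  then have "subtopology Z K homeomorphic_space subtopology RJ S"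
    by (auto simp: homeomorphic_space_def)
  then show ?thesis
    using S unfolding RC_def RJ_def by (rule realcompact_spaceI[rotated])
qed

text \<open>In the one-point compactification \<open>Z\<close> the image of \<open>K\<close> is
  still G-delta closed. G-delta sets of \<open>Y\<close> remain G-delta because \<open>Y\<close> is
  open in \<open>Z\<close>, and the point at infinity is a G-delta set because \<open>Y\<close> is
  covered by countably many compact sets.\<close>

lemma realcompact_space_gdelta_closed_in_sigma_compact:
  assumes Y: "locally_compact_space Y" "Hausdorff_space Y"
    and c: "countable \<C>" "\<And>C. C \<in> \<C> \<Longrightarrow> compactin Y C" "topspace Y \<subseteq> \<Union>\<C>"
    and K: "gdelta_closedin Y K"
  shows "realcompact_space (subtopology Y K)"
proof -
  define Z where "Z = Alexandroff_compactification Y"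
  have Z: "compact_space Z" "Hausdorff_space Z"
    using Y by (auto simp: Z_def Hausdorff_space_Alexandroff_compactification)
  have KY: "K \<subseteq> topspace Y" using K by (auto simp: gdelta_closedin_iff)
  have emb: "embedding_map Y Z Some" by (simp add: Z_def embedding_map_Some)
  have "gdelta_closedin Z (Some ` K)"
    unfolding gdelta_closedin_iff
  proof (intro conjI ballI)
    show "Some ` K \<subseteq> topspace Z" using KY by (auto simp: Z_def)
    fix z assume z: "z \<in> topspace Z - Some ` K"
    show "\<exists>Q. gdelta_in Z Q \<and> z \<in> Q \<and> Q \<inter> Some ` K = {}"
    proof (cases z)
      case None
      \<comment> \<open>Only the point at infinity lies outside the images of all members of
        \<open>\<C>\<close>. Inserting \<open>topspace Z\<close> keeps the intersected family
        nonempty.\<close>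
      have "gdelta_in Z (\<Inter>(insert (topspace Z) ((\<lambda>C. topspace Z - Some ` C) ` \<C>)))"
      proof (rule gdelta_in_Inter)
        fix T assume "T \<in> insert (topspace Z) ((\<lambda>C. topspace Z - Some ` C) ` \<C>)"
        moreover have "closedin Z (Some ` C)" if "C \<in> \<C>" for C
          using c that Y by (simp add: Z_def compactin_imp_closedin)
        ultimately show "gdelta_in Z T" by (auto intro: open_imp_gdelta_in)
      qed (use c in auto)
      moreover have "z \<in> \<Inter>(insert (topspace Z) ((\<lambda>C. topspace Z - Some ` C) ` \<C>))"
        using None z by auto
      moreover have "\<Inter>(insert (topspace Z) ((\<lambda>C. topspace Z - Some ` C) ` \<C>)) \<inter> Some ` K = {}"
      proof (rule equals0I)
        fix w assume w: "w \<in> \<Inter>(insert (topspace Z) ((\<lambda>C. topspace Z - Some ` C) ` \<C>)) \<inter> Some ` K"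
        then obtain y where y: "y \<in> K" "w = Some y" by blast
        then obtain C where "C \<in> \<C>" "y \<in> C" using c(3) KY by blast
        then show False using w y(2) by (auto split: if_splits)
      qed
      ultimately show ?thesis by (intro exI conjI)
    next
      case (Some y)
      then have "y \<in> topspace Y - K" using z by (auto simp: Z_def)
      then obtain Q where Q: "gdelta_in Y Q" "y \<in> Q" "Q \<inter> K = {}"
        using K unfolding gdelta_closedin_iff by blast
      then obtain C where C: "\<And>n::nat. openin Y (C n)" "\<Inter>(range C) = Q"
        by (auto simp: gdelta_in_descending)
      have "gdelta_in Z (\<Inter>n. Some ` C n)"
        by (rule gdelta_in_Inter) (use C in \<open>auto simp: Z_def intro!: open_imp_gdelta_in\<close>)
      moreover have "(\<Inter>n. Some ` C n) = Some ` Q"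
        unfolding C(2)[symmetric] by (rule image_INT[symmetric, where C=UNIV and j=0]) auto
      moreover have "Some ` Q \<inter> Some ` K = {}" "z \<in> Some ` Q"
        using Q Some by auto
      ultimately show ?thesis by metis
    qed
  qed
  then have "realcompact_space (subtopology Z (Some ` K))"
    using realcompact_space_gdelta_closed_in_compact Z by blast
  moreover have "subtopology Y K homeomorphic_space subtopology Z (Some ` K)"
  proof -
    have "homeomorphic_map Y (subtopology Z (Some ` topspace Y)) Some"
      using emb by (simp add: embedding_map_def)
    then have "homeomorphic_map (subtopology Y K) (subtopology (subtopology Z (Some ` topspace Y)) (Some ` K)) Some"
      by (rule homeomorphic_map_subtopologies) (use KY in \<open>auto simp: Z_def\<close>)
    moreover have "Some ` topspace Y \<inter> Some ` K = Some ` K" using KY by auto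
    ultimately show ?thesis
      by (simp add: subtopology_subtopology homeomorphic_map_imp_homeomorphic_space)
  qed
  ultimately show ?thesis
    using realcompact_space_homeomorphic homeomorphic_space_sym by blast
qed

text \<open>Zorn's lemma applies since a union of a chain of disjoint families is disjoint. A set
  \<open>P\<close> that met no member of a maximal family could be adjoined, hence would belong to
  it already; but a nonempty set meets itself.\<close>

lemma maximal_disjoint_subfamily:
  assumes "{} \<notin> \<A>"
  obtains \<M> where "\<M> \<subseteq> \<A>" "pairwise disjnt \<M>" "\<forall>P\<in>\<A>. \<exists>Q\<in>\<M>. P \<inter> Q \<noteq> {}"
proof -
  define \<D> where "\<D> = {\<M>. \<M> \<subseteq> \<A> \<and> pairwise disjnt \<M>}"
  have "\<exists>\<M>\<in>\<D>. \<forall>X\<in>\<D>. \<M> \<subseteq> X \<longrightarrow> X = \<M>"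
  proof (rule subset_Zorn')
    fix \<C> assume \<C>: "subset.chain \<D> \<C>"
    have "pairwise disjnt (\<Union>\<C>)"
    proof (rule pairwiseI)
      fix P Q assume "P \<in> \<Union>\<C>" "Q \<in> \<Union>\<C>" "P \<noteq> Q"
      then obtain X1 X2 where X12: "X1 \<in> \<C>" "P \<in> X1" "X2 \<in> \<C>" "Q \<in> X2" by blast
      then have "X1 \<subseteq> X2 \<or> X2 \<subseteq> X1" using \<C> by (simp add: subset_chain_def)
      then obtain X where X: "X \<in> \<C>" "P \<in> X" "Q \<in> X" using X12 by blast
      then have "pairwise disjnt X" using \<C> by (auto simp: subset_chain_def \<D>_def)
      with X show "disjnt P Q" using \<open>P \<noteq> Q\<close> by (meson pairwiseD)
    qed
    then show "\<Union>\<C> \<in> \<D>" using \<C> by (auto simp: subset_chain_def \<D>_def)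
  qed
  then obtain \<M> where \<M>: "\<M> \<in> \<D>" "\<And>X. X \<in> \<D> \<Longrightarrow> \<M> \<subseteq> X \<Longrightarrow> X = \<M>" by blast
  show ?thesis
  proof
    show "\<M> \<subseteq> \<A>" "pairwise disjnt \<M>" using \<M>(1) by (auto simp: \<D>_def)
    show "\<forall>P\<in>\<A>. \<exists>Q\<in>\<M>. P \<inter> Q \<noteq> {}"
    proof (rule ballI, rule ccontr)
      fix P assume P: "P \<in> \<A>" and n: "\<not> (\<exists>Q\<in>\<M>. P \<inter> Q \<noteq> {})"
      then have "insert P \<M> \<in> \<D>"
        using \<M>(1) P by (auto simp: \<D>_def pairwise_insert disjnt_def)
      then have "P \<in> \<M>" using \<M>(2) by blast
      then show False using n P assms by auto
    qed
  qed
qed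

section \<open>Countable chain condition and $G_\delta$-subgroups\<close>

context topological_group
begin

section \<open>Continuous translations and neighborhoods of the identity\<close>

lemma continuous_map_mult:
  assumes "continuous_map X T f" "continuous_map X T g"
  shows "continuous_map X T (\<lambda>x. f x \<otimes> g x)"
proof -
  have "continuous_map X (prod_topology T T) (\<lambda>x. (f x, g x))"
    using assms by (simp add: continuous_map_paired)
  from continuous_map_compose[OF this continuous_mult] show ?thesis
    by (simp add: o_def)
qed

lemma continuous_map_inv:
  assumes "continuous_map X T f"
  shows "continuous_map X T (\<lambda>x. inv (f x))"
  using continuous_map_compose[OF assms continuous_inv] by (simp add: o_def)

lemma continuous_map_carrier_const:
  "a \<in> carrier G \<Longrightarrow> continuous_map X T (\<lambda>x. a)"
  by (simp add: topspace_eq_carrier)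

text \<open>Translates are written below as preimages, such as
  \<open>{y \<in> carrier G. inv x \<otimes> y \<in> V}\<close> for the left translate of
  \<open>V\<close> by \<open>x\<close>. These rules supply the continuity that makes such sets open
  or G-delta.\<close>

lemmas continuous_map_group_intros =
  continuous_map_mult continuous_map_inv continuous_map_carrier_const continuous_map_id[unfolded id_def]

lemma openin_preimage:
  assumes "continuous_map T T f" "openin T U"
  shows "openin T {y \<in> carrier G. f y \<in> U}"
  using openin_continuous_map_preimage[OF assms] by (simp add: topspace_eq_carrier)

lemma gdelta_in_preimage:
  assumes "continuous_map T T f" "gdelta_in T U"
  shows "gdelta_in T {y \<in> carrier G. f y \<in> U}"
  using gdelta_in_continuous_map_preimage[OF assms] by (simp add: topspace_eq_carrier)

lemma openin_subset_carrier: "openin T U \<Longrightarrow> U \<subseteq> carrier G"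
  using openin_subset topspace_eq_carrier by blast

lemma inv_mult_cancel_left [simp]:
  assumes "x \<in> carrier G" "y \<in> carrier G" 
  shows "inv x \<otimes> (x \<otimes> y) = y" "x \<otimes> (inv x \<otimes> y) = y"
  using assms by (simp_all flip: m_assoc)

lemma mult_inv_cancel_right [simp]:
  assumes "x \<in> carrier G" "y \<in> carrier G" 
  shows "(x \<otimes> y) \<otimes> inv y = x" "(x \<otimes> inv y) \<otimes> y = x"
  using assms by (simp_all add: m_assoc)

text \<open>Continuity of the multiplication at the pair of identities gives a box
  \<open>A \<times> B\<close> that is mapped into \<open>U\<close>. Intersecting its sides with each
  other and with \<open>U\<close>, and the result with its own inverse, yields
  \<open>V\<close>.\<close>

lemma nhd_one_mult:
  assumes U: "openin T U" "\<one> \<in> U"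
  obtains V where "openin T V" "\<one> \<in> V" "V \<subseteq> U" "\<forall>x\<in>V. inv x \<in> V"
    "\<forall>x\<in>V. \<forall>y\<in>V. x \<otimes> y \<in> U"
proof -
  have "openin (prod_topology T T) {p \<in> topspace (prod_topology T T). (\<lambda>(x, y). x \<otimes> y) p \<in> U}"
    by (rule openin_continuous_map_preimage[OF continuous_mult U(1)])
  moreover have "(\<one>, \<one>) \<in> {p \<in> topspace (prod_topology T T). (\<lambda>(x, y). x \<otimes> y) p \<in> U}"
    using U by (simp add: topspace_eq_carrier)
  ultimately obtain A B where AB: "openin T A" "openin T B" "\<one> \<in> A" "\<one> \<in> B"
    "A \<times> B \<subseteq> {p \<in> topspace (prod_topology T T). (\<lambda>(x, y). x \<otimes> y) p \<in> U}"
    unfolding openin_prod_topology_alt by meson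
  define W where "W = A \<inter> B \<inter> U"
  define V where "V = W \<inter> {x \<in> carrier G. inv x \<in> W}"
  have W: "openin T W" "\<one> \<in> W" using AB U by (auto simp: W_def)
  show ?thesis
  proof
    show "openin T V"
      unfolding V_def using W by (intro openin_Int openin_preimage continuous_inv)
    show "\<one> \<in> V" "V \<subseteq> U" using W by (auto simp: V_def W_def)
    show "\<forall>x\<in>V. inv x \<in> V" by (auto simp: V_def)
    show "\<forall>x\<in>V. \<forall>y\<in>V. x \<otimes> y \<in> U"
    proof (intro ballI)
      fix x y assume that: "x \<in> V" "y \<in> V"
      have "(x, y) \<in> A \<times> B" using that by (auto simp: V_def W_def)
      then show "x \<otimes> y \<in> U" using AB(5) by auto
    qed
  qed
qed

text \<open>For a fixed \<open>x\<close> in \<open>D\<close>, the left translate of \<open>D\<close>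
  by \<open>c \<otimes> inv x\<close> contains \<open>c\<close>. So the open translates of
  \<open>D\<close> cover \<open>C\<close>, and compactness leaves finitely many of them.\<close>

lemma compactin_finite_translates:
  assumes C: "compactin T C" and D: "openin T D" "D \<noteq> {}"
  obtains F where "finite F" "F \<subseteq> carrier G" "\<forall>c\<in>C. \<exists>t\<in>F. \<exists>d\<in>D. c = t \<otimes> d"
proof -
  obtain x where x: "x \<in> D" using D by blast
  have xc: "x \<in> carrier G" using x D openin_subset_carrier by blast
  define P where "P = (\<lambda>t. {y \<in> carrier G. inv t \<otimes> y \<in> D})"
  have P: "openin T (P t)" if "t \<in> carrier G" for t
    unfolding P_def using D that by (intro openin_preimage continuous_map_group_intros) auto
  have CG: "C \<subseteq> carrier G" using C compactin_subset_topspace topspace_eq_carrier by blast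
  have "C \<subseteq> \<Union>(P ` carrier G)"
  proof
    fix c assume "c \<in> C"
    then have c: "c \<in> carrier G" using CG by blast
    have "inv (c \<otimes> inv x) \<otimes> c = x" using c xc by (simp add: inv_mult_group m_assoc)
    then have "c \<in> P (c \<otimes> inv x)" using c x by (simp add: P_def)
    then show "c \<in> \<Union>(P ` carrier G)"
      by (rule UN_I[rotated]) (use c xc in auto)
  qed
  moreover have "\<forall>U\<in>P ` carrier G. openin T U" using P by blast
  ultimately obtain \<F> where \<F>: "finite \<F>" "\<F> \<subseteq> P ` carrier G" "C \<subseteq> \<Union>\<F>"
    using C unfolding compactin_def by meson
  then obtain F where F: "finite F" "F \<subseteq> carrier G" "\<F> = P ` F"
    by (meson finite_subset_image)
  have "\<forall>c\<in>C. \<exists>t\<in>F. \<exists>d\<in>D. c = t \<otimes> d"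
  proof
    fix c assume c: "c \<in> C"
    then obtain t where t: "t \<in> F" "c \<in> P t" using \<F> F by blast
    then have "inv t \<otimes> c \<in> D" "c = t \<otimes> (inv t \<otimes> c)"
      using F CG c by (auto simp: P_def subset_iff)
    then show "\<exists>t\<in>F. \<exists>d\<in>D. c = t \<otimes> d" using t by blast
  qed
  with F(1,2) show ?thesis by (rule that)
qed

text \<open>Counting translates plays the role of Haar measure. If \<open>n\<close> translates of a
  part \<open>D P\<close> of \<open>P\<close> suffice to cover \<open>C\<close>, then
  \<open>P\<close> takes up at least the fraction \<open>1/n\<close> of a smallest cover of
  \<open>C\<close> by translates of a small set, so at most \<open>n\<close> disjoint members are of
  this kind. The family is the union over \<open>n\<close> of these finite subfamilies.\<close>

lemma countable_disjoint_open_in_compact: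
  assumes C: "compactin T C" and disj: "pairwise disjnt \<O>"
    and op: "\<And>P. P \<in> \<O> \<Longrightarrow> openin T P \<and> P \<noteq> {} \<and> P \<subseteq> C"
  shows "countable \<O>"
proof -
  have "\<exists>D V F. D \<subseteq> P \<and> openin T V \<and> \<one> \<in> V \<and> (\<forall>d\<in>D. \<forall>v\<in>V. d \<otimes> v \<in> P) \<and>
      finite F \<and> F \<subseteq> carrier G \<and> (\<forall>c\<in>C. \<exists>t\<in>F. \<exists>d\<in>D. c = t \<otimes> d)" if P: "P \<in> \<O>" for P
  proof -
    obtain x where x: "x \<in> P" using op[OF P] by blast
    have PG: "openin T P" "P \<subseteq> carrier G" using op[OF P] openin_subset_carrier by auto
    then have xc: "x \<in> carrier G" using x by blast
    have "openin T {y \<in> carrier G. x \<otimes> y \<in> P}"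
      using PG xc by (intro openin_preimage continuous_map_group_intros)
    moreover have "\<one> \<in> {y \<in> carrier G. x \<otimes> y \<in> P}" using x xc by simp
    ultimately obtain V where V: "openin T V" "\<one> \<in> V" "V \<subseteq> {y \<in> carrier G. x \<otimes> y \<in> P}"
      "\<forall>u\<in>V. inv u \<in> V" "\<forall>u\<in>V. \<forall>v\<in>V. u \<otimes> v \<in> {y \<in> carrier G. x \<otimes> y \<in> P}"
      by (rule nhd_one_mult)
    \<comment> \<open>\<open>D\<close> is the translate of \<open>V\<close> by \<open>x\<close>, and
      \<open>V\<close> was chosen so small that even \<open>D\<close> times \<open>V\<close> stays
      inside \<open>P\<close>. This margin separates different members of the family later
      on.\<close>
    define D where "D = {y \<in> carrier G. inv x \<otimes> y \<in> V}"
    have D: "openin T D" 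
      unfolding D_def using V xc by (intro openin_preimage continuous_map_group_intros) auto
    have "x \<in> D" using xc V by (simp add: D_def)
    then obtain F where F: "finite F" "F \<subseteq> carrier G" "\<forall>c\<in>C. \<exists>t\<in>F. \<exists>d\<in>D. c = t \<otimes> d"
      using compactin_finite_translates[OF C D] by blast
    have dv: "d \<otimes> v \<in> P" if "d \<in> D" "v \<in> V" for d v
    proof -
      have dc: "d \<in> carrier G" "inv x \<otimes> d \<in> V" using that by (auto simp: D_def)
      have "v \<in> carrier G" using that V openin_subset_carrier by blast
      then have "x \<otimes> ((inv x \<otimes> d) \<otimes> v) = d \<otimes> v" using dc xc by (simp add: m_assoc)
      then show ?thesis using V(5) dc(2) that(2) by fastforce
    qed
    have "D \<subseteq> P"
    proof
      fix d assume d: "d \<in> D"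
      then have "d \<in> carrier G" by (simp add: D_def)
      then show "d \<in> P" using dv[OF d V(2)] by simp
    qed
    then show ?thesis using V(1,2) F dv
      by (intro exI[of _ D] exI[of _ V] exI[of _ F]) simp
  qed
  then obtain D V F where DVF: "\<And>P. P \<in> \<O> \<Longrightarrow> D P \<subseteq> P \<and> openin T (V P) \<and> \<one> \<in> V P \<and>
      (\<forall>d\<in>D P. \<forall>v\<in>V P. d \<otimes> v \<in> P) \<and>
      finite (F P) \<and> F P \<subseteq> carrier G \<and> (\<forall>c\<in>C. \<exists>t\<in>F P. \<exists>d\<in>D P. c = t \<otimes> d)"
    by metis
  \<comment> \<open>Double counting: the sets \<open>EE P\<close> are disjoint parts of one minimal
    cover \<open>E\<close>, and each has at least \<open>card E / n\<close> elements.\<close>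
  have bound: "card \<P> \<le> n" if fin: "finite \<P>" and sub: "\<P> \<subseteq> {P \<in> \<O>. card (F P) \<le> n}" for \<P> n
  proof (cases "\<P> = {}")
    case False
    define V0 where "V0 = \<Inter>(V ` \<P>)"
    have "openin T (V P)" "\<one> \<in> V P" if "P \<in> \<P>" for P
      using that sub DVF by blast+
    then have "openin T V0" "\<one> \<in> V0"
      unfolding V0_def using fin False by (auto intro!: openin_Inter)
    then obtain U where U: "openin T U" "\<one> \<in> U" "U \<subseteq> V0" "\<forall>x\<in>U. inv x \<in> U"
      "\<forall>x\<in>U. \<forall>y\<in>U. x \<otimes> y \<in> V0"
      by (rule nhd_one_mult)
    have UG: "U \<subseteq> carrier G" using U openin_subset_carrier by blast
    define cov where "cov = (\<lambda>E. finite E \<and> E \<subseteq> carrier G \<and> (\<forall>c\<in>C. \<exists>t\<in>E. \<exists>d\<in>U. c = t \<otimes> d))"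
    have "U \<noteq> {}" using U(2) by blast
    then obtain E0 where "finite E0" "E0 \<subseteq> carrier G" "\<forall>c\<in>C. \<exists>t\<in>E0. \<exists>d\<in>U. c = t \<otimes> d"
      by (rule compactin_finite_translates[OF C U(1)])
    then have "cov E0" by (simp add: cov_def)
    then obtain E where E: "cov E" "\<And>E'. cov E' \<Longrightarrow> card E \<le> card E'"
      using ex_has_least_nat[of cov E0 card] by blast
    \<comment> \<open>\<open>EE P\<close> collects the centers whose translate of \<open>U\<close>
      meets \<open>D P\<close>.\<close>
    define EE where "EE = (\<lambda>P. {g \<in> E. \<exists>u\<in>U. g \<otimes> u \<in> D P})"
    have Ef: "finite E" "E \<subseteq> carrier G" using E by (auto simp: cov_def)
    \<comment> \<open>If the translate of \<open>U\<close> by \<open>g\<close> met both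
      \<open>D P\<close> and \<open>D P'\<close>, passing from \<open>g \<otimes> u\<close> to
      \<open>g \<otimes> u'\<close> would multiply by an element of \<open>V P\<close>. The margin
      of \<open>D P\<close> then puts \<open>g \<otimes> u'\<close> into \<open>P\<close> as well as
      into \<open>P'\<close>.\<close>
    have EEd: "EE P \<inter> EE P' = {}" if "P \<in> \<P>" "P' \<in> \<P>" "P \<noteq> P'" for P P'
    proof (rule equals0I)
      fix g assume "g \<in> EE P \<inter> EE P'"
      then obtain u u' where u: "u \<in> U" "g \<otimes> u \<in> D P" "u' \<in> U" "g \<otimes> u' \<in> D P'" "g \<in> carrier G"
        using Ef by (auto simp: EE_def)
      have uc: "u \<in> carrier G" "u' \<in> carrier G" using u UG by auto
      have "inv u \<otimes> u' \<in> V P"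
        using U(4,5) u(1,3) \<open>P \<in> \<P>\<close> by (simp add: V0_def)
      then have "(g \<otimes> u) \<otimes> (inv u \<otimes> u') \<in> P"
        using u(2) DVF sub \<open>P \<in> \<P>\<close> by blast
      then have "g \<otimes> u' \<in> P" using u uc by (simp add: m_assoc)
      moreover have "g \<otimes> u' \<in> P'" using u DVF sub \<open>P' \<in> \<P>\<close> by blast
      moreover have "disjnt P P'"
        using disj that sub unfolding pairwise_def by blast
      ultimately show False by (auto simp: disjnt_def)
    qed
    \<comment> \<open>The products of \<open>F P\<close> with \<open>EE P\<close> are again centers
      of a cover of \<open>C\<close>: write \<open>c = t \<otimes> d\<close> with \<open>d\<close>
      in \<open>D P\<close>, then \<open>d = g \<otimes> u\<close> with \<open>g\<close> in
      \<open>E\<close>. Minimality of \<open>E\<close> gives the inequality.\<close>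
    have EEc: "card E \<le> n * card (EE P)" if "P \<in> \<P>" for P
    proof -
      have PO: "P \<in> \<O>" "card (F P) \<le> n" using that sub by auto
      define E' where "E' = (\<lambda>(t, g). t \<otimes> g) ` (F P \<times> EE P)"
      have FP: "finite (F P)" "F P \<subseteq> carrier G" using DVF[OF PO(1)] by auto
      have EP: "finite (EE P)" "EE P \<subseteq> carrier G" using Ef by (auto simp: EE_def)
      have "cov E'"
        unfolding cov_def
      proof (intro conjI ballI)
        show "finite E'" unfolding E'_def using FP EP by blast
        show "E' \<subseteq> carrier G" using FP EP by (auto simp: E'_def)
        fix c assume "c \<in> C"
        then obtain t d where t: "t \<in> F P" "d \<in> D P" "c = t \<otimes> d" using DVF[OF PO(1)] by blast
        then have "d \<in> C" using DVF[OF PO(1)] op[OF PO(1)] by blast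
        then obtain g u where g: "g \<in> E" "u \<in> U" "d = g \<otimes> u" using E(1) unfolding cov_def by blast
        then have "g \<in> EE P" using t by (auto simp: EE_def)
        then have "t \<otimes> g \<in> E'" unfolding E'_def using t by force
        moreover have "c = (t \<otimes> g) \<otimes> u"
        proof -
          have "t \<in> carrier G" "g \<in> carrier G" "u \<in> carrier G" using t g FP Ef UG by auto
          then show ?thesis using t g by (simp add: m_assoc)
        qed
        ultimately show "\<exists>t\<in>E'. \<exists>d\<in>U. c = t \<otimes> d" using g by blast
      qed
      then have "card E \<le> card E'" using E by blast
      also have "\<dots> \<le> card (F P \<times> EE P)" unfolding E'_def using FP EP by (intro card_image_le) auto
      also have "\<dots> \<le> n * card (EE P)" using PO by (simp add: card_cartesian_product)
      finally show ?thesis .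
    qed
    have "card \<P> * card E = (\<Sum>P\<in>\<P>. card E)" by simp
    also have "\<dots> \<le> (\<Sum>P\<in>\<P>. n * card (EE P))" by (rule sum_mono) (rule EEc)
    also have "\<dots> = n * card (\<Union>P\<in>\<P>. EE P)"
      using fin EEd Ef by (subst card_UN_disjoint) (auto simp: EE_def sum_distrib_left)
    also have "\<dots> \<le> n * card E"
      by (intro mult_le_mono2 card_mono) (use Ef in \<open>auto simp: EE_def\<close>)
    finally have "card \<P> * card E \<le> n * card E" .
    moreover have "card E > 0"
    proof -
      obtain P where "P \<in> \<P>" using False by blast
      then have "P \<noteq> {}" "P \<subseteq> C" using sub op by blast+
      then have "E \<noteq> {}" using E(1) unfolding cov_def by blast
      then show ?thesis using Ef by (simp add: card_gt_0_iff)
    qed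
    ultimately show ?thesis by simp
  qed simp
  have "finite {P \<in> \<O>. card (F P) \<le> n}" for n
  proof (rule ccontr)
    assume "infinite {P \<in> \<O>. card (F P) \<le> n}"
    then obtain \<P> where "finite \<P>" "card \<P> = Suc n" "\<P> \<subseteq> {P \<in> \<O>. card (F P) \<le> n}"
      using infinite_arbitrarily_large by blast
    then show False using bound[of \<P> n] by simp
  qed
  then have "countable (\<Union>n. {P \<in> \<O>. card (F P) \<le> n})"
    by (intro countable_UN) (auto intro: countable_finite)
  moreover have "\<O> \<subseteq> (\<Union>n. {P \<in> \<O>. card (F P) \<le> n})" by auto
  ultimately show ?thesis by (rule countable_subset[rotated])
qed

text \<open>Choose symmetric neighborhoods of the identity, each containing all products of two
  elements of the next. Their intersection is closed under products and inverses.\<close>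

lemma gdelta_subgroup_in_nhd_one:
  assumes U: "openin T U" "\<one> \<in> U"
  obtains N where "subgroup N G" "gdelta_in T N" "N \<subseteq> U"
proof -
  define P where "P = (\<lambda>V. openin T V \<and> \<one> \<in> V \<and> V \<subseteq> U \<and> (\<forall>x\<in>V. inv x \<in> V))"
  have "\<exists>f. \<forall>n::nat. P (f n) \<and> (\<forall>x\<in>f (Suc n). \<forall>y\<in>f (Suc n). x \<otimes> y \<in> f n)"
  proof (rule dependent_nat_choice)
    obtain V where "openin T V" "\<one> \<in> V" "V \<subseteq> U" "\<forall>x\<in>V. inv x \<in> V"
      "\<forall>x\<in>V. \<forall>y\<in>V. x \<otimes> y \<in> U"
      by (rule nhd_one_mult[OF U])
    then show "\<exists>V. P V" unfolding P_def by blast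
  next
    fix V and n :: nat assume V: "P V"
    then have "openin T V" "\<one> \<in> V" by (auto simp: P_def)
    then obtain W where "openin T W" "\<one> \<in> W" "W \<subseteq> V" "\<forall>x\<in>W. inv x \<in> W"
      "\<forall>x\<in>W. \<forall>y\<in>W. x \<otimes> y \<in> V"
      by (rule nhd_one_mult)
    moreover from this have "P W" using V by (simp add: P_def subset_trans)
    ultimately show "\<exists>W. P W \<and> (\<forall>x\<in>W. \<forall>y\<in>W. x \<otimes> y \<in> V)"
      by (intro exI[of _ W] conjI)
  qed
  then obtain f where f: "\<And>n::nat. P (f n)" "\<And>n x y. x \<in> f (Suc n) \<Longrightarrow> y \<in> f (Suc n) \<Longrightarrow> x \<otimes> y \<in> f n"
    by blast
  show ?thesis
  proof
    show "subgroup (\<Inter>n. f n) G"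
    proof
      show "(\<Inter>n. f n) \<subseteq> carrier G" using f(1)[of 0] openin_subset_carrier by (auto simp: P_def)
      show "\<one> \<in> (\<Inter>n. f n)" using f(1) by (auto simp: P_def)
    qed (use f in \<open>auto simp: P_def\<close>)
    show "gdelta_in T (\<Inter>n. f n)"
      by (rule gdelta_in_Inter) (use f(1) in \<open>auto simp: P_def intro: open_imp_gdelta_in\<close>)
    show "(\<Inter>n. f n) \<subseteq> U" using f(1)[of 0] by (auto simp: P_def)
  qed
qed

section \<open>Limits at points of the $G_\delta$-closure\<close>

text \<open>A maximal disjoint family of sets of small oscillation is countable, so the subgroups
  that leave its members invariant have a G-delta intersection \<open>N0\<close>. A point
  \<open>g\<close> of \<open>A\<close> in the coset of \<open>x\<close> modulo \<open>N0\<close> has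
  a neighborhood of small oscillation; translating it to \<open>x\<close> respects every member of
  the family, and these members link values of \<open>f\<close> near \<open>x\<close> to values near
  \<open>g\<close>.\<close>

lemma small_oscillation_at_gdelta_limit:
  assumes lc: "locally_compact_space T"
    and A: "A \<subseteq> carrier G" "T closure_of A = carrier G"
    and W: "openin T W" "x \<in> W"
    and met: "Metric_space M d"
    and f: "continuous_map (subtopology T (A \<inter> W)) (Metric_space.mtopology M d) f"
    and meets: "\<And>Q. gdelta_in T Q \<Longrightarrow> x \<in> Q \<Longrightarrow> Q \<inter> A \<noteq> {}"
    and e: "0 < e"
  obtains Q where "openin T Q" "x \<in> Q" "Q \<subseteq> W" "\<forall>a\<in>Q \<inter> A. \<forall>b\<in>Q \<inter> A. d (f a) (f b) < e"
proof -
  interpret Metric_space M d by (rule met)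
  have fM: "f a \<in> M" if "a \<in> A" "a \<in> W" for a
    using continuous_map_image_subset_topspace[OF f] that A by (force simp: topspace_eq_carrier)
  have dense: "P \<inter> A \<noteq> {}" if "openin T P" "P \<noteq> {}" for P
  proof -
    have "T closure_of A = topspace T" using A topspace_eq_carrier by simp
    then show ?thesis using that unfolding dense_intersects_open by blast
  qed
  \<comment> \<open>Three steps of length \<open>e/6\<close> will lead from \<open>f a\<close> to
    \<open>f g\<close>, and the detour from \<open>f a\<close> to \<open>f b\<close> through
    \<open>f g\<close> then stays below \<open>e\<close>. The radius \<open>e/12\<close> below makes
    two values in one ball differ by less than \<open>e/6\<close>.\<close>
  define small where "small = (\<lambda>S. \<forall>a\<in>S \<inter> A. \<forall>b\<in>S \<inter> A. d (f a) (f b) < e/6)"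
  have local_small: "\<exists>Q. openin T Q \<and> g \<in> Q \<and> Q \<subseteq> W \<and> small Q" if g: "g \<in> A" "g \<in> W" for g
  proof -
    have "openin (subtopology T (A \<inter> W)) {y \<in> topspace (subtopology T (A \<inter> W)). f y \<in> mball (f g) (e/12)}"
      by (rule openin_continuous_map_preimage[OF f]) simp
    then obtain P where P: "openin T P"
      "{y \<in> topspace (subtopology T (A \<inter> W)). f y \<in> mball (f g) (e/12)} = P \<inter> (A \<inter> W)"
      unfolding openin_subtopology by blast
    have mem: "f y \<in> mball (f g) (e/12)" if "y \<in> P" "y \<in> A" "y \<in> W" for y
      using that P(2) by blast
    have "g \<in> P"
      using g P(2) fM[OF g] e A by (auto simp: topspace_eq_carrier)
    moreover have "small (P \<inter> W)"
      unfolding small_def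
    proof (intro ballI)
      fix a b assume "a \<in> P \<inter> W \<inter> A" "b \<in> P \<inter> W \<inter> A"
      then have "f a \<in> mball (f g) (e/12)" "f b \<in> mball (f g) (e/12)" using mem by auto
      then show "d (f a) (f b) < e/6"
        using triangle''[of "f a" "f g" "f b"] commute[of "f g" "f a"] by (simp add: in_mball)
    qed
    ultimately show ?thesis using P W g by (intro exI[of _ "P \<inter> W"]) auto
  qed
  have "x \<in> topspace T" using W openin_subset by blast
  then obtain V0 C where C: "openin T V0" "compactin T C" "x \<in> V0" "V0 \<subseteq> C"
    using lc unfolding locally_compact_space_def by blast
  define W1 where "W1 = V0 \<inter> W"
  have W1: "openin T W1" "x \<in> W1" "W1 \<subseteq> C" "W1 \<subseteq> W" using C W by (auto simp: W1_def)
  \<comment> \<open>Invariance under right multiplication by \<open>N\<close> makes \<open>P\<close>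
    a union of left cosets of \<open>N\<close>. Staying inside \<open>W1\<close>, hence inside the
    compact set \<open>C\<close>, makes disjoint subfamilies countable.\<close>
  define \<A> where "\<A> = {P. openin T P \<and> P \<noteq> {} \<and> P \<subseteq> W1 \<and> small P \<and>
      (\<exists>N. subgroup N G \<and> gdelta_in T N \<and> (\<forall>y\<in>P. \<forall>n\<in>N. y \<otimes> n \<in> P))}"
  \<comment> \<open>Around a point \<open>g\<close> of \<open>A\<close> in \<open>P\<close> the
    function oscillates little. With \<open>N\<close> inside \<open>V\<close>, the set
    \<open>P'\<close> of all products \<open>g \<otimes> (v \<otimes> n)\<close> is invariant under
    \<open>N\<close> and still lies in the chosen neighborhood of \<open>g\<close>, since a product
    of two elements of \<open>V\<close> is small enough.\<close>
  have ex\<A>: "\<exists>P'\<in>\<A>. P' \<subseteq> P" if P: "openin T P" "P \<noteq> {}" "P \<subseteq> W1" for P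
  proof -
    obtain g where g: "g \<in> P" "g \<in> A" using dense[OF P(1,2)] by blast
    have "g \<in> W" using g P W1 by blast
    from local_small[OF g(2) this] obtain Q where Q: "openin T Q" "g \<in> Q" "Q \<subseteq> W" "small Q"
      by blast
    have gc: "g \<in> carrier G" using g A by blast
    have "openin T {v \<in> carrier G. g \<otimes> v \<in> P \<inter> Q}"
      using P Q gc by (intro openin_preimage continuous_map_group_intros openin_Int)
    moreover have "\<one> \<in> {v \<in> carrier G. g \<otimes> v \<in> P \<inter> Q}" using g Q gc by simp
    ultimately obtain V where V: "openin T V" "\<one> \<in> V" "V \<subseteq> {v \<in> carrier G. g \<otimes> v \<in> P \<inter> Q}"
      "\<forall>v\<in>V. inv v \<in> V" "\<forall>u\<in>V. \<forall>v\<in>V. u \<otimes> v \<in> {v \<in> carrier G. g \<otimes> v \<in> P \<inter> Q}"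
      by (rule nhd_one_mult)
    obtain N where N: "subgroup N G" "gdelta_in T N" "N \<subseteq> V"
      using gdelta_subgroup_in_nhd_one[OF V(1,2)] by blast
    interpret N: subgroup N G by (rule N)
    have VG: "V \<subseteq> carrier G" using V by blast
    define P' where "P' = {g \<otimes> (v \<otimes> n) | v n. v \<in> V \<and> n \<in> N}"
    have "P' = (\<Union>n\<in>N. {y \<in> carrier G. inv g \<otimes> y \<otimes> inv n \<in> V})"
    proof (intro equalityI subsetI)
      fix y assume "y \<in> P'"
      then obtain v n where vn: "v \<in> V" "n \<in> N" "y = g \<otimes> (v \<otimes> n)" by (auto simp: P'_def)
      then have "v \<in> carrier G" "n \<in> carrier G" using VG N.subset by auto
      with vn gc show "y \<in> (\<Union>n\<in>N. {y \<in> carrier G. inv g \<otimes> y \<otimes> inv n \<in> V})"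
        by (intro UN_I[OF vn(2)]) simp
    next
      fix y assume "y \<in> (\<Union>n\<in>N. {y \<in> carrier G. inv g \<otimes> y \<otimes> inv n \<in> V})"
      then obtain n where n: "n \<in> N" "y \<in> carrier G" "inv g \<otimes> y \<otimes> inv n \<in> V" by blast
      have "n \<in> carrier G" using n N.subset by auto
      then have "y = g \<otimes> ((inv g \<otimes> y \<otimes> inv n) \<otimes> n)" using n gc by simp
      with n show "y \<in> P'" unfolding P'_def by blast
    qed
    moreover have "openin T \<dots>"
    proof (intro openin_Union[of _ T] ballI, clarify)
      fix n assume "n \<in> N"
      then have "n \<in> carrier G" using N.subset by auto
      then show "openin T {y \<in> carrier G. inv g \<otimes> y \<otimes> inv n \<in> V}"
        using V gc by (intro openin_preimage continuous_map_group_intros) auto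
    qed
    ultimately have "openin T P'" by simp
    moreover have "P' \<subseteq> P \<inter> Q" using V(5) N(3) by (auto simp: P'_def)
    moreover have "P' \<noteq> {}" using V(2) N.one_closed unfolding P'_def by blast
    moreover have "y \<otimes> n' \<in> P'" if y: "y \<in> P'" and n': "n' \<in> N" for y n'
    proof -
      obtain v n where vn: "v \<in> V" "n \<in> N" "y = g \<otimes> (v \<otimes> n)" using y by (auto simp: P'_def)
      then have "v \<in> carrier G" "n \<in> carrier G" "n' \<in> carrier G" using VG N.subset n' by auto
      then have "y \<otimes> n' = g \<otimes> (v \<otimes> (n \<otimes> n'))" using vn gc by (simp add: m_assoc)
      then show ?thesis using vn n' N.m_closed unfolding P'_def by blast
    qed
    moreover have "small P'" using Q(4) \<open>P' \<subseteq> P \<inter> Q\<close> unfolding small_def by blast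
    ultimately have "P' \<in> \<A>" "P' \<subseteq> P" using N(1,2) P(3) unfolding \<A>_def by auto
    then show ?thesis by blast
  qed
  have "{} \<notin> \<A>" by (simp add: \<A>_def)
  then obtain \<M> where \<M>: "\<M> \<subseteq> \<A>" "pairwise disjnt \<M>" "\<forall>P\<in>\<A>. \<exists>Q\<in>\<M>. P \<inter> Q \<noteq> {}"
    by (rule maximal_disjoint_subfamily)
  have \<M>o: "openin T P" "P \<noteq> {}" "P \<subseteq> W1" "small P" if "P \<in> \<M>" for P
    using that \<M>(1) by (auto simp: \<A>_def)
  have meet\<M>: "\<exists>P'\<in>\<M>. P \<inter> P' \<noteq> {}" if "openin T P" "P \<noteq> {}" "P \<subseteq> W1" for P
    using ex\<A>[OF that] \<M>(3) by blast
  have "countable \<M>"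
  proof (rule countable_disjoint_open_in_compact[OF C(2) \<M>(2)])
    show "openin T P \<and> P \<noteq> {} \<and> P \<subseteq> C" if "P \<in> \<M>" for P
      using \<M>o(1-3)[OF that] W1(3) by simp
  qed
  have "\<forall>P\<in>\<M>. \<exists>N. subgroup N G \<and> gdelta_in T N \<and> (\<forall>y\<in>P. \<forall>n\<in>N. y \<otimes> n \<in> P)"
    using \<M>(1) by (auto simp: \<A>_def)
  then obtain N where N: "\<And>P. P \<in> \<M> \<Longrightarrow> subgroup (N P) G" "\<And>P. P \<in> \<M> \<Longrightarrow> gdelta_in T (N P)"
    "\<And>P y n. P \<in> \<M> \<Longrightarrow> y \<in> P \<Longrightarrow> n \<in> N P \<Longrightarrow> y \<otimes> n \<in> P"
    by metis
  \<comment> \<open>Inserting \<open>carrier G\<close> makes the intersected family nonempty without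
    a case distinction.\<close>
  define N0 where "N0 = \<Inter>(insert (carrier G) (N ` \<M>))"
  have N0: "subgroup N0 G"
    unfolding N0_def using N(1) subgroup_self by (intro subgroups_Inter) auto
  have "gdelta_in T N0"
    unfolding N0_def using N(2) \<open>countable \<M>\<close> gdelta_in_topspace[of T]
    by (intro gdelta_in_Inter) (auto simp: topspace_eq_carrier)
  have xc: "x \<in> carrier G" using W openin_subset_carrier by blast
  \<comment> \<open>This is the part in \<open>W1\<close> of the left coset of \<open>N0\<close>
    through \<open>x\<close>. It is a G-delta set around \<open>x\<close>, so \<open>meets\<close>
    provides a point \<open>g\<close> of \<open>A\<close> in it.\<close>
  have "gdelta_in T ({y \<in> carrier G. inv x \<otimes> y \<in> N0} \<inter> W1)"
  proof (rule gdelta_in_Int)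
    show "gdelta_in T {y \<in> carrier G. inv x \<otimes> y \<in> N0}"
      using \<open>gdelta_in T N0\<close> xc by (intro gdelta_in_preimage continuous_map_group_intros) auto
  qed (use W1 in \<open>simp add: open_imp_gdelta_in\<close>)
  moreover have "x \<in> {y \<in> carrier G. inv x \<otimes> y \<in> N0} \<inter> W1"
    using xc W1 N0 subgroup.one_closed by auto
  ultimately obtain g where g: "g \<in> A" "g \<in> W1" "inv x \<otimes> g \<in> N0" "g \<in> carrier G"
    using meets by blast
  define n where "n = inv x \<otimes> g"
  have n: "n \<in> N0" "n \<in> carrier G" "x \<otimes> n = g" using g xc by (auto simp: n_def)
  have "g \<in> W" using g W1 by blast
  from local_small[OF g(1) this] obtain Q where Q: "openin T Q" "g \<in> Q" "Q \<subseteq> W" "small Q"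
    by blast
  \<comment> \<open>Right translation by \<open>n\<close> takes \<open>x\<close> to
    \<open>g\<close>; \<open>Q'\<close> is the preimage of \<open>Q\<close> under it, cut down to
    \<open>W1\<close>.\<close>
  define Q' where "Q' = {y \<in> carrier G. y \<otimes> n \<in> Q} \<inter> W1"
  have Q': "openin T Q'" "x \<in> Q'" "Q' \<subseteq> W1"
    unfolding Q'_def using Q n W1 xc
    by (auto intro!: openin_Int openin_preimage continuous_map_group_intros)
  \<comment> \<open>Every member of \<open>\<M>\<close> that meets \<open>Q'\<close> also meets \<open>Q\<close>, because it is invariant under \<open>n\<close>.\<close>
  have near: "d (f a) (f g) < e/2" if a: "a \<in> Q' \<inter> A" for a
  proof -
    have aW: "a \<in> A" "a \<in> W" using a Q' W1 by auto
    obtain R where R: "openin T R" "a \<in> R" "R \<subseteq> W" "small R"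
      using local_small[OF aW] by blast
    have "openin T (R \<inter> Q')" "R \<inter> Q' \<noteq> {}" "R \<inter> Q' \<subseteq> W1" using R Q' a by auto
    then obtain P where P: "P \<in> \<M>" "R \<inter> Q' \<inter> P \<noteq> {}" using meet\<M> by blast
    have "openin T (R \<inter> Q' \<inter> P)" using R Q' \<M>o[OF P(1)] by auto
    then obtain a' where a': "a' \<in> R" "a' \<in> Q'" "a' \<in> P" "a' \<in> A" using dense P(2) by blast
    \<comment> \<open>The point \<open>a' \<otimes> n\<close> lies in \<open>Q \<inter> P\<close>
      but possibly outside \<open>A\<close>, where nothing is known about \<open>f\<close>. Density
      replaces it by the point \<open>a''\<close> of \<open>A\<close>.\<close>
    have "n \<in> N P" using n(1) P(1) by (simp add: N0_def)
    then have "a' \<otimes> n \<in> P" using N(3) P(1) a' by blast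
    moreover have "a' \<otimes> n \<in> Q" using a' by (simp add: Q'_def)
    ultimately have "Q \<inter> P \<noteq> {}" by blast
    moreover have "openin T (Q \<inter> P)" using Q \<M>o[OF P(1)] by auto
    ultimately obtain a'' where a'': "a'' \<in> Q" "a'' \<in> P" "a'' \<in> A" using dense by blast
    have "d (f a) (f a') < e/6" using R(4) R(2) a a' by (simp add: small_def)
    moreover have "d (f a') (f a'') < e/6" using \<M>o(4)[OF P(1)] a' a'' by (simp add: small_def)
    moreover have "d (f a'') (f g) < e/6" using Q(4) Q(2) a'' g by (simp add: small_def)
    moreover have "f a \<in> M" "f a' \<in> M" "f a'' \<in> M" "f g \<in> M"
      using aW a' a'' g Q Q' W1 by (auto intro!: fM)
    ultimately show ?thesis
      using triangle[of "f a" "f a'" "f g"] triangle[of "f a'" "f a''" "f g"] by simp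
  qed
  have "d (f a) (f b) < e" if "a \<in> Q' \<inter> A" "b \<in> Q' \<inter> A" for a b
  proof -
    have "f a \<in> M" "f b \<in> M" "f g \<in> M" using that g Q' W1 by (auto intro!: fM)
    then show ?thesis
      using triangle[of "f a" "f g" "f b"] near[OF that(1)] near[OF that(2)] commute[of "f g" "f b"] by simp
  qed
  moreover have "Q' \<subseteq> W" using Q' W1 by blast
  ultimately show thesis using Q'(1,2) that by simp
qed

text \<open>The neighborhoods of \<open>x\<close> on which \<open>f\<close> oscillates by less than
  \<open>inverse (Suc n)\<close> intersect in a G-delta set, which contains a point \<open>g\<close>
  of \<open>A\<close>. The value \<open>f g\<close> is the limit; finding it as an actual value of
  \<open>f\<close> replaces completeness of the metric.\<close>

lemma metrizable_limit_at_gdelta_closure: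
  assumes lc: "locally_compact_space T"
    and A: "A \<subseteq> carrier G" "T closure_of A = carrier G"
    and W: "openin T W" "x \<in> W"
    and M: "metrizable_space M"
    and f: "continuous_map (subtopology T (A \<inter> W)) M f"
    and meets: "\<And>Q. gdelta_in T Q \<Longrightarrow> x \<in> Q \<Longrightarrow> Q \<inter> A \<noteq> {}"
  shows "\<exists>l. limitin M f l (atin_within T x A)"
proof -
  obtain S d where S: "Metric_space S d" "M = Metric_space.mtopology S d"
    using M unfolding metrizable_space_def by blast
  interpret Metric_space S d by (rule S)
  have fc: "continuous_map (subtopology T (A \<inter> W)) mtopology f" using f S by simp
  have fS: "f a \<in> S" if "a \<in> A" "a \<in> W" for a
    using continuous_map_image_subset_topspace[OF fc] that A by (force simp: topspace_eq_carrier)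
  have "\<exists>Q. openin T Q \<and> x \<in> Q \<and> Q \<subseteq> W \<and> (\<forall>a\<in>Q \<inter> A. \<forall>b\<in>Q \<inter> A. d (f a) (f b) < inverse (Suc n))" for n
    by (rule small_oscillation_at_gdelta_limit[OF lc A W S(1) fc meets, of "inverse (Suc n)"]) auto
  then obtain Q where Q: "\<And>n. openin T (Q n)" "\<And>n. x \<in> Q n" "\<And>n. Q n \<subseteq> W"
      "\<And>n a b. a \<in> Q n \<inter> A \<Longrightarrow> b \<in> Q n \<inter> A \<Longrightarrow> d (f a) (f b) < inverse (Suc n)"
    by metis
  have "gdelta_in T (\<Inter>n. Q n)"
    by (rule gdelta_in_Inter) (use Q in \<open>auto intro: open_imp_gdelta_in\<close>)
  then obtain g where g: "g \<in> A" "\<And>n. g \<in> Q n" using meets[of "\<Inter>n. Q n"] Q(2) by blast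
  have "limitin mtopology f (f g) (atin_within T x A)"
    unfolding limitin_metric
  proof (intro conjI allI impI)
    show "f g \<in> S" using g Q(3) fS by blast
    fix e :: real assume "e > 0"
    then obtain n where n: "inverse (Suc n) < e" using reals_Archimedean by blast
    have "f a \<in> S \<and> d (f a) (f g) < e" if "a \<in> Q n" "a \<in> A" for a
      using fS Q(3)[of n] Q(4)[of a n g] that g n by force
    then show "\<forall>\<^sub>F a in atin_within T x A. f a \<in> S \<and> d (f a) (f g) < e"
      unfolding eventually_atin_within using Q(1,2)[of n] by blast
  qed
  then show ?thesis using S by blast
qed

text \<open>Were \<open>x\<close> outside \<open>A\<close>, every coordinate of a closed embedding
  of \<open>B\<close> would still have a limit at \<open>x\<close>. These limits form a point of the
  closed image, so the inclusion of \<open>B\<close> converges at \<open>x\<close> to a point of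
  \<open>B\<close>, which must be \<open>x\<close> because limits are unique.\<close>

lemma Dieudonne_complete_near_gdelta_limit:
  assumes lc: "locally_compact_space T"
    and A: "A \<subseteq> carrier G" "T closure_of A = carrier G"
    and W: "openin T W" "x \<in> W"
    and B: "A \<inter> W \<subseteq> B" "B \<subseteq> A" "Dieudonne_complete_space (subtopology T B)"
    and meets: "\<And>Q. gdelta_in T Q \<Longrightarrow> x \<in> Q \<Longrightarrow> Q \<inter> A \<noteq> {}"
  shows "x \<in> A"
proof (rule ccontr)
  assume xA: "x \<notin> A"
  define F where "F = atin_within T x A"
  have xc: "x \<in> topspace T" using W openin_subset by blast
  obtain I and M :: "('a \<Rightarrow> 'a) \<times> 'a topology \<Rightarrow> 'a topology" and S
    where M: "\<And>i. i\<in>I \<Longrightarrow> metrizable_space (M i)" and S: "closedin (product_topology M I) S"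
      and hom: "subtopology T B homeomorphic_space subtopology (product_topology M I) S"
    using B(3) unfolding Dieudonne_complete_space_def by blast
  then obtain h h' where h: "homeomorphic_maps (subtopology T B) (subtopology (product_topology M I) S) h h'"
    by (auto simp: homeomorphic_space_def)
  have hc: "continuous_map (subtopology T B) (product_topology M I) h"
    and hS: "\<And>b. b \<in> B \<Longrightarrow> h b \<in> S"
    using h B A by (auto simp: homeomorphic_maps_def continuous_map_in_subtopology topspace_eq_carrier)
  \<comment> \<open>\<open>F\<close> is a punctured filter. It is proper because \<open>x\<close>
    lies in the closure of \<open>A\<close> but not in \<open>A\<close>, hence is an accumulation
    point.\<close>
  have nontriv: "F \<noteq> bot"
  proof -
    have "x \<in> T closure_of A" using A xc topspace_eq_carrier by simp
    then have "x \<in> T derived_set_of A" using xA by (auto simp: closure_of_def derived_set_of_def)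
    then show ?thesis unfolding F_def derived_set_of_trivial_limit .
  qed
  have evB: "\<forall>\<^sub>F a in F. a \<in> B"
    unfolding F_def eventually_atin_within using W B by blast
  have "\<exists>l. limitin (M i) (\<lambda>a. h a i) l F" if i: "i \<in> I" for i
  proof -
    have "continuous_map (subtopology T B) (M i) (\<lambda>a. h a i)"
      using hc i by (simp add: continuous_map_componentwise)
    then have "continuous_map (subtopology T (A \<inter> W)) (M i) (\<lambda>a. h a i)"
      by (rule continuous_map_from_subtopology_mono) (use B in auto)
    then show ?thesis
      unfolding F_def using metrizable_limit_at_gdelta_closure[OF lc A W M[OF i] _ meets] by blast
  qed
  then obtain l where l: "\<And>i. i \<in> I \<Longrightarrow> limitin (M i) (\<lambda>a. h a i) (l i) F" by metis
  have "limitin (product_topology M I) h (restrict l I) F"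
    unfolding limitin_componentwise
  proof (intro conjI ballI)
    have "\<forall>\<^sub>F a in F. h a \<in> topspace (product_topology M I)"
      using evB by eventually_elim (use hS closedin_subset[OF S] in blast)
    then show "\<forall>\<^sub>F a in F. h a \<in> topspace (product_topology M I)" .
  qed (use l in auto)
  then have lim: "limitin (product_topology M I) h (restrict l I) F" .
  have evS: "\<forall>\<^sub>F a in F. h a \<in> S" using evB by eventually_elim (rule hS)
  then have "restrict l I \<in> S"
    using limitin_closedin[OF lim S _ nontriv] by blast
  with lim evS have "limitin (subtopology (product_topology M I) S) h (restrict l I) F"
    by (simp add: limitin_subtopology)
  then have "limitin (subtopology T B) (h' \<circ> h) (h' (restrict l I)) F"
    using h by (intro continuous_map_limit) (auto simp: homeomorphic_maps_def)
  then have lB: "limitin T (h' \<circ> h) (h' (restrict l I)) F" "h' (restrict l I) \<in> B"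
    by (auto simp: limitin_subtopology)
  have "limitin T (h' \<circ> h) x F"
  proof (rule limitin_transform_eventually)
    show "limitin T (\<lambda>a. a) x F"
      unfolding limitin_def F_def eventually_atin_within using xc by blast
    show "\<forall>\<^sub>F a in F. a = (h' \<circ> h) a"
      using evB by eventually_elim (use h A B in \<open>auto simp: homeomorphic_maps_def topspace_eq_carrier\<close>)
  qed
  then have "x \<in> B"
    using limitin_Hausdorff_unique[OF _ lB(1) nontriv Hausdorff] lB(2) by blast
  then show False using B xA by blast
qed

text \<open>By density, a point \<open>x\<close> of the G-delta closure can be brought into
  \<open>W\<close> by right multiplication with the inverse of some \<open>a\<close> in
  \<open>A\<close>. This translation maps \<open>A\<close> to itself, so the new point is in the
  G-delta closure too, hence in \<open>A\<close>, and so is \<open>x\<close>.\<close>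

lemma gdelta_closedin_if_Dieudonne_complete_nhd:
  assumes lc: "locally_compact_space T"
    and A: "subgroup A G" "T closure_of A = carrier G"
    and W: "openin T W" "\<one> \<in> W"
    and B: "A \<inter> W \<subseteq> B" "B \<subseteq> A" "Dieudonne_complete_space (subtopology T B)"
  shows "gdelta_closedin T A"
  unfolding gdelta_closedin_iff
proof (intro conjI ballI, rule_tac [2] ccontr)
  interpret A: subgroup A G by (rule A)
  show "A \<subseteq> topspace T" using A.subset topspace_eq_carrier by simp
  fix x assume x: "x \<in> topspace T - A" and n: "\<not> (\<exists>Q. gdelta_in T Q \<and> x \<in> Q \<and> Q \<inter> A = {})"
  then have xc: "x \<in> carrier G" "x \<notin> A" by (auto simp: topspace_eq_carrier)
  have "openin T {y \<in> carrier G. x \<otimes> inv y \<in> W}"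
    using W xc by (intro openin_preimage continuous_map_group_intros)
  moreover have "x \<in> {y \<in> carrier G. x \<otimes> inv y \<in> W}" using xc W by simp
  moreover have "x \<in> T closure_of A" using A(2) xc by simp
  ultimately obtain a where "a \<in> A" "a \<in> {y \<in> carrier G. x \<otimes> inv y \<in> W}"
    unfolding in_closure_of by meson
  then have a: "a \<in> A" "x \<otimes> inv a \<in> W" "a \<in> carrier G" by auto
  have "x \<otimes> inv a \<in> A"
  proof (rule Dieudonne_complete_near_gdelta_limit[OF lc A.subset A(2) W(1) a(2) B])
    fix Q assume Q: "gdelta_in T Q" "x \<otimes> inv a \<in> Q"
    have "gdelta_in T {y \<in> carrier G. y \<otimes> inv a \<in> Q}"
      using Q a by (intro gdelta_in_preimage continuous_map_group_intros) auto
    moreover have "x \<in> {y \<in> carrier G. y \<otimes> inv a \<in> Q}" using xc Q by simp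
    ultimately obtain b where "b \<in> A" "b \<otimes> inv a \<in> Q" using n by blast
    moreover then have "b \<otimes> inv a \<in> A" using a by simp
    ultimately show "Q \<inter> A \<noteq> {}" by blast
  qed
  then have "x \<otimes> inv a \<otimes> a \<in> A" using A.m_closed a(1) by blast
  then show False using xc a by simp
qed

section \<open>Open and $\sigma$-compact subgroups\<close>

lemma homeomorphic_map_left_mult:
  assumes "a \<in> carrier G"
  shows "homeomorphic_map T T (\<lambda>x. a \<otimes> x)"
proof -
  have "homeomorphic_maps T T (\<lambda>x. a \<otimes> x) (\<lambda>x. inv a \<otimes> x)"
    unfolding homeomorphic_maps_def using assms
    by (intro conjI continuous_map_group_intros) (auto simp: topspace_eq_carrier)
  then show ?thesis by (auto simp: homeomorphic_map_maps)
qed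

lemma closedin_open_subgroup:
  assumes "subgroup L G" "openin T L"
  shows "closedin T L"
proof -
  interpret L: subgroup L G by (rule assms)
  have "openin T (topspace T - L)"
  proof (subst openin_subopen, intro ballI)
    fix x assume "x \<in> topspace T - L"
    then have x: "x \<in> carrier G" "x \<notin> L" by (auto simp: topspace_eq_carrier)
    have "openin T {y \<in> carrier G. inv x \<otimes> y \<in> L}"
      using assms x by (intro openin_preimage continuous_map_group_intros) auto
    moreover have "{y \<in> carrier G. inv x \<otimes> y \<in> L} \<subseteq> topspace T - L"
    proof (intro subsetI DiffI notI)
      fix y assume y: "y \<in> {y \<in> carrier G. inv x \<otimes> y \<in> L}" and "y \<in> L"
      then have "y \<otimes> inv (inv x \<otimes> y) \<in> L" by blast
      then show False using x y by (simp add: inv_mult_group)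
    qed (auto simp: topspace_eq_carrier)
    moreover have "x \<in> {y \<in> carrier G. inv x \<otimes> y \<in> L}" using x by simp
    ultimately show "\<exists>U. openin T U \<and> x \<in> U \<and> U \<subseteq> topspace T - L" by blast
  qed
  then show ?thesis using assms L.subset by (simp add: closedin_def topspace_eq_carrier)
qed

text \<open>The left coset of \<open>K\<close> through \<open>x\<close> is a homeomorphic copy of
  \<open>K\<close>. It is closed as well as open, so it is its own closure, as the local
  completeness properties require.\<close>

lemma open_subgroup_coset:
  assumes K: "subgroup K G" "openin T K" and x: "x \<in> carrier G"
  obtains U where "openin T U" "x \<in> U" "T closure_of U = U"
    "subtopology T K homeomorphic_space subtopology T U"
proof -
  interpret K: subgroup K G by (rule K)
  define U where "U = (\<lambda>y. x \<otimes> y) ` K"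
  have hom: "homeomorphic_map T T (\<lambda>y. x \<otimes> y)" by (rule homeomorphic_map_left_mult[OF x])
  have KT: "K \<subseteq> topspace T" using K.subset by (simp add: topspace_eq_carrier)
  show thesis
  proof (rule that)
    show "openin T U" unfolding U_def
      using homeomorphic_map_openness[OF hom KT] K by simp
    show "x \<in> U" unfolding U_def using x K.one_closed by (intro image_eqI[of _ _ \<one>]) auto
    have "closedin T U" unfolding U_def
      using homeomorphic_map_closedness[OF hom KT] closedin_open_subgroup[OF K] by simp
    then show "T closure_of U = U" by (rule closure_of_closedin)
    have "topspace T \<inter> U = U" using \<open>openin T U\<close> openin_subset by blast
    then have "homeomorphic_map (subtopology T K) (subtopology T U) (\<lambda>y. x \<otimes> y)"
      using KT hom by (intro homeomorphic_map_subtopologies) (auto simp: U_def)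
    then show "subtopology T K homeomorphic_space subtopology T U"
      by (rule homeomorphic_map_imp_homeomorphic_space)
  qed
qed

text \<open>This is the subgroup generated by a compact neighborhood of the identity. Starting from
  its symmetric hull \<open>D\<close>, repeated squaring gives compact sets \<open>E n\<close>,
  which increase because they contain the identity.\<close>

lemma sigma_compact_open_subgroup:
  assumes lc: "locally_compact_space T"
  obtains L \<C> where "subgroup L G" "openin T L" "countable \<C>" "\<forall>C\<in>\<C>. compactin T C" "L = \<Union>\<C>"
proof -
  have "\<one> \<in> topspace T" by (simp add: topspace_eq_carrier)
  then obtain V C where V: "openin T V" "compactin T C" "\<one> \<in> V" "V \<subseteq> C"
    using lc unfolding locally_compact_space_def by blast
  define D where "D = C \<union> (\<lambda>x. inv x) ` C"
  define E where "E = rec_nat D (\<lambda>n S. (\<lambda>(x, y). x \<otimes> y) ` (S \<times> S))"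
  have E0: "E 0 = D" and ES: "\<And>n. E (Suc n) = (\<lambda>(x, y). x \<otimes> y) ` (E n \<times> E n)"
    by (simp_all add: E_def)
  have Ec: "compactin T (E n)" for n
  proof (induction n)
    case 0
    show ?case unfolding E0 D_def using V image_compactin[OF V(2) continuous_inv]
      by (intro compactin_Un) auto
  next
    case (Suc n)
    show ?case unfolding ES
      by (rule image_compactin[OF _ continuous_mult]) (use Suc in \<open>simp add: compactin_Times\<close>)
  qed
  have EG: "E n \<subseteq> carrier G" for n
    using compactin_subset_topspace[OF Ec] by (simp add: topspace_eq_carrier)
  have CG: "C \<subseteq> carrier G"
    using compactin_subset_topspace[OF V(2)] by (simp add: topspace_eq_carrier)
  have E1: "\<one> \<in> E n" for n
  proof (induction n)
    case (Suc n)
    show ?case unfolding ES by (rule image_eqI[of _ _ "(\<one>, \<one>)"]) (use Suc in auto)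
  qed (use V in \<open>auto simp: E0 D_def\<close>)
  have Einv: "inv x \<in> E n" if "x \<in> E n" for n x
    using that
  proof (induction n arbitrary: x)
    case 0
    then show ?case using CG by (force simp: E0 D_def)
  next
    case (Suc n)
    from Suc.prems obtain y z where yz: "y \<in> E n" "z \<in> E n" "x = y \<otimes> z"
      unfolding ES by auto
    then have "y \<in> carrier G" "z \<in> carrier G" using EG by blast+
    then have "inv x = inv z \<otimes> inv y" using yz by (simp add: inv_mult_group)
    then show ?case unfolding ES by (intro image_eqI[of _ _ "(inv z, inv y)"]) (use Suc.IH yz in auto)
  qed
  have "E n \<subseteq> E (Suc n)" for n
  proof
    fix x assume x: "x \<in> E n"
    then have "x \<in> carrier G" using EG by blast
    then show "x \<in> E (Suc n)"
      unfolding ES by (intro image_eqI[of _ _ "(x, \<one>)"]) (use E1 x in auto)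
  qed
  then have Emono: "E m \<subseteq> E n" if "m \<le> n" for m n
    using lift_Suc_mono_le[of E] that by blast
  define L where "L = (\<Union>n. E n)"
  have L: "subgroup L G"
  proof
    show "L \<subseteq> carrier G" using EG by (auto simp: L_def)
    show "\<one> \<in> L" using E1 by (auto simp: L_def)
    show "inv x \<in> L" if "x \<in> L" for x using that Einv by (auto simp: L_def)
    show "x \<otimes> y \<in> L" if xy: "x \<in> L" "y \<in> L" for x y
    proof -
      obtain m n where mn: "x \<in> E m" "y \<in> E n" using xy by (auto simp: L_def)
      then have "x \<in> E (max m n)" "y \<in> E (max m n)"
        using Emono[of m "max m n"] Emono[of n "max m n"] by auto
      then have "x \<otimes> y \<in> E (Suc (max m n))" unfolding ES by force
      then show ?thesis unfolding L_def by blast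
    qed
  qed
  interpret L: subgroup L G by (rule L)
  have VL: "V \<subseteq> L"
  proof
    fix v assume "v \<in> V"
    then have "v \<in> E 0" using V(4) by (auto simp: E0 D_def)
    then show "v \<in> L" unfolding L_def by blast
  qed
  have "openin T L"
  proof (subst openin_subopen, intro ballI)
    fix x assume x: "x \<in> L"
    then have xc: "x \<in> carrier G" by auto
    have "openin T {y \<in> carrier G. inv x \<otimes> y \<in> V}"
      using V xc by (intro openin_preimage continuous_map_group_intros) auto
    moreover have "x \<in> {y \<in> carrier G. inv x \<otimes> y \<in> V}" using xc V by simp
    moreover have "{y \<in> carrier G. inv x \<otimes> y \<in> V} \<subseteq> L"
    proof
      fix y assume y: "y \<in> {y \<in> carrier G. inv x \<otimes> y \<in> V}"
      then have "x \<otimes> (inv x \<otimes> y) \<in> L" using x VL by blast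
      then show "y \<in> L" using y xc by simp
    qed
    ultimately show "\<exists>U. openin T U \<and> x \<in> U \<and> U \<subseteq> L" by blast
  qed
  moreover have "countable (range E)" "\<forall>C\<in>range E. compactin T C" "L = \<Union>(range E)"
    using Ec by (auto simp: L_def)
  ultimately show thesis using that L by blast
qed

text \<open>Countably many translates of a small \<open>V\<close> cover \<open>K\<close>. In each
  one that meets \<open>K\<close>, a point of \<open>K\<close> replaces the center: two points
  \<open>t \<otimes> v'\<close> and \<open>t \<otimes> v\<close> differ by
  \<open>inv v' \<otimes> v\<close>, which lies in \<open>W\<close>. Thus the net lies in
  \<open>K\<close> itself, as omega-precompactness demands.\<close>

lemma countable_net_of_sigma_compact:
  assumes \<C>: "countable \<C>" "\<forall>C\<in>\<C>. compactin T C" and K: "K \<subseteq> \<Union>\<C>"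
    and W: "openin T W" "\<one> \<in> W"
  obtains S where "countable S" "S \<subseteq> K" "\<forall>k\<in>K. \<exists>s\<in>S. inv s \<otimes> k \<in> W"
proof -
  obtain V where V: "openin T V" "\<one> \<in> V" "V \<subseteq> W" "\<forall>v\<in>V. inv v \<in> V" "\<forall>u\<in>V. \<forall>v\<in>V. u \<otimes> v \<in> W"
    by (rule nhd_one_mult[OF W])
  have VG: "V \<subseteq> carrier G" by (rule openin_subset_carrier[OF V(1)])
  have "\<forall>C\<in>\<C>. \<exists>F. finite F \<and> F \<subseteq> carrier G \<and> (\<forall>c\<in>C. \<exists>t\<in>F. \<exists>v\<in>V. c = t \<otimes> v)"
  proof
    fix C assume "C \<in> \<C>"
    then have "compactin T C" using \<C> by blast
    moreover have "V \<noteq> {}" using V by blast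
    ultimately obtain F where "finite F" "F \<subseteq> carrier G" "\<forall>c\<in>C. \<exists>t\<in>F. \<exists>v\<in>V. c = t \<otimes> v"
      using V(1) by (rule_tac compactin_finite_translates)
    then show "\<exists>F. finite F \<and> F \<subseteq> carrier G \<and> (\<forall>c\<in>C. \<exists>t\<in>F. \<exists>v\<in>V. c = t \<otimes> v)" by blast
  qed
  then obtain F where F: "\<And>C. C \<in> \<C> \<Longrightarrow> finite (F C) \<and> F C \<subseteq> carrier G \<and> (\<forall>c\<in>C. \<exists>t\<in>F C. \<exists>v\<in>V. c = t \<otimes> v)"
    by metis
  define E where "E = {t \<in> \<Union>(F ` \<C>). \<exists>k\<in>K. \<exists>v\<in>V. k = t \<otimes> v}"
  have "\<forall>t\<in>E. \<exists>k. k \<in> K \<and> (\<exists>v\<in>V. k = t \<otimes> v)" by (auto simp: E_def)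
  then obtain p where p: "\<And>t. t \<in> E \<Longrightarrow> p t \<in> K \<and> (\<exists>v\<in>V. p t = t \<otimes> v)" by metis
  have "countable (\<Union>(F ` \<C>))"
    using \<C>(1) F by (intro countable_UN) (auto intro: countable_finite)
  then have "countable E" unfolding E_def by (rule countable_subset[rotated]) blast
  have "\<exists>s\<in>p ` E. inv s \<otimes> k \<in> W" if k: "k \<in> K" for k
  proof -
    obtain C where C: "C \<in> \<C>" "k \<in> C" using K k by blast
    then obtain t v where t: "t \<in> F C" "v \<in> V" "k = t \<otimes> v" using F by blast
    then have tE: "t \<in> E" using C k unfolding E_def by blast
    then obtain v' where v': "v' \<in> V" "p t = t \<otimes> v'" using p by blast
    have "t \<in> carrier G" "v \<in> carrier G" "v' \<in> carrier G" using t v' VG F[OF C(1)] by auto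
    then have "inv (p t) \<otimes> k = inv v' \<otimes> v" using t v' by (simp add: inv_mult_group m_assoc)
    moreover have "inv v' \<otimes> v \<in> W" using V v' t by blast
    ultimately show ?thesis using tE by force
  qed
  then show thesis
    using that[of "p ` E"] \<open>countable E\<close> p by blast
qed

text \<open>\<open>K\<close> lies in the union \<open>Y\<close> of countably many left cosets of
  \<open>L\<close>. This union is open, hence locally compact, and is covered by countably many
  translates of the compact pieces of \<open>L\<close>.\<close>

lemma realcompact_in_sigma_compact_cosets:
  assumes lc: "locally_compact_space T"
    and L: "subgroup L G" "openin T L" "countable \<C>" "\<forall>C\<in>\<C>. compactin T C" "L = \<Union>\<C>"
    and S: "countable S" "S \<subseteq> carrier G"
    and K: "gdelta_closedin T K" "\<forall>k\<in>K. \<exists>s\<in>S. inv s \<otimes> k \<in> L"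
  shows "realcompact_space (subtopology T K)"
proof -
  interpret L: subgroup L G by (rule L)
  have KG: "K \<subseteq> carrier G" using K(1) by (auto simp: gdelta_closedin_iff topspace_eq_carrier)
  define Y where "Y = (\<Union>s\<in>S. {y \<in> carrier G. inv s \<otimes> y \<in> L})"
  have "openin T {y \<in> carrier G. inv s \<otimes> y \<in> L}" if "s \<in> S" for s
    using L(2) S that by (intro openin_preimage continuous_map_group_intros) auto
  then have Y: "openin T Y" unfolding Y_def by blast
  have KY: "K \<subseteq> Y" using K(2) KG unfolding Y_def by blast
  define \<C>' where "\<C>' = (\<Union>s\<in>S. (\<lambda>C. (\<lambda>x. s \<otimes> x) ` C) ` \<C>)"
  have "realcompact_space (subtopology (subtopology T Y) K)"
  proof (rule realcompact_space_gdelta_closed_in_sigma_compact)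
    show "locally_compact_space (subtopology T Y)"
      using lc Y Hausdorff by (intro locally_compact_space_open_subset) auto
    show "Hausdorff_space (subtopology T Y)" by (rule Hausdorff_space_subtopology[OF Hausdorff])
    show "countable \<C>'" unfolding \<C>'_def using S L by blast
    show "compactin (subtopology T Y) C" if C: "C \<in> \<C>'" for C
    proof -
      obtain s C0 where s: "s \<in> S" "C0 \<in> \<C>" "C = (\<lambda>x. s \<otimes> x) ` C0"
        using C unfolding \<C>'_def by blast
      have sc: "s \<in> carrier G" using s S by blast
      have "compactin T C" unfolding s(3)
        using L(4) s(2) sc by (intro image_compactin[where X=T] continuous_map_group_intros) auto
      moreover have "C \<subseteq> Y"
      proof
        fix y assume "y \<in> C"
        then obtain l where "l \<in> L" "y = s \<otimes> l" using s L(5) by blast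
        then show "y \<in> Y" using sc s(1) unfolding Y_def by (intro UN_I[of s]) auto
      qed
      ultimately show ?thesis by (simp add: compactin_subtopology)
    qed
    show "topspace (subtopology T Y) \<subseteq> \<Union>\<C>'"
    proof
      fix y assume "y \<in> topspace (subtopology T Y)"
      then obtain s where s: "s \<in> S" "y \<in> carrier G" "inv s \<otimes> y \<in> L" by (auto simp: Y_def)
      then obtain C where C: "C \<in> \<C>" "inv s \<otimes> y \<in> C" using L(5) by blast
      have "s \<otimes> (inv s \<otimes> y) = y" using s S by auto
      then have "y \<in> (\<lambda>x. s \<otimes> x) ` C" using C by force
      then show "y \<in> \<Union>\<C>'" using s C unfolding \<C>'_def by blast
    qed
    \<comment> \<open>The inclusion of \<open>Y\<close> is also continuous for the G-delta
      topologies, so \<open>K\<close> stays G-delta closed in \<open>Y\<close>.\<close>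
    have "continuous_map (subtopology T Y) T id" by (simp add: continuous_map_from_subtopology)
    from closedin_continuous_map_preimage[OF continuous_map_gdelta_topology[OF this] K(1)]
    have "gdelta_closedin (subtopology T Y) {x \<in> topspace T \<inter> Y. x \<in> K}" by simp
    moreover have "{x \<in> topspace T \<inter> Y. x \<in> K} = K" using KY KG by (auto simp: topspace_eq_carrier)
    ultimately show "gdelta_closedin (subtopology T Y) K" by simp
  qed
  then show ?thesis using KY by (simp add: subtopology_subtopology Int_absorb1)
qed

text \<open>With one representative \<open>r a\<close> for each coset, \<open>a\<close> corresponds
  to the pair of \<open>inv (r a) \<otimes> a\<close> and \<open>r a\<close>. This identifies
  \<open>A\<close> with the product of the realcompact space \<open>A \<inter> L\<close> and a
  discrete, hence metrizable, space.\<close>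

lemma Dieudonne_complete_gdelta_closed_subgroup:
  assumes lc: "locally_compact_space T" and A: "subgroup A G" "gdelta_closedin T A"
  shows "Dieudonne_complete_space (subtopology T A)"
proof -
  interpret A: subgroup A G by (rule A)
  obtain L \<C> where L: "subgroup L G" "openin T L" "countable \<C>" "\<forall>C\<in>\<C>. compactin T C" "L = \<Union>\<C>"
    by (rule sigma_compact_open_subgroup[OF lc])
  interpret L: subgroup L G by (rule L)
  define K where "K = A \<inter> L"
  have Kgd: "gdelta_closedin T K"
    unfolding K_def using A(2) closedin_imp_gdelta_closedin[OF closedin_open_subgroup[OF L(1,2)]]
    by (rule closedin_Int)
  have "realcompact_space (subtopology T K)"
    by (rule realcompact_in_sigma_compact_cosets[OF lc L, of "{\<one>}"]) (use Kgd in \<open>auto simp: K_def\<close>)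
  then have KD: "Dieudonne_complete_space (subtopology T K)"
    by (rule realcompact_imp_Dieudonne_complete_space)
  define r where "r = (\<lambda>a. SOME b. b \<in> A \<and> inv a \<otimes> b \<in> L)"
  have r: "r a \<in> A" "inv a \<otimes> r a \<in> L" if "a \<in> A" for a
  proof -
    have "a \<in> A \<and> inv a \<otimes> a \<in> L" using that by simp
    from someI[of "\<lambda>b. b \<in> A \<and> inv a \<otimes> b \<in> L", OF this] show "r a \<in> A" "inv a \<otimes> r a \<in> L"
      unfolding r_def by auto
  qed
  \<comment> \<open>The predicate behind the choice depends only on the coset of \<open>a\<close>,
    so elements of the same coset receive the same representative.\<close>
  have r_eq: "r a = r b" if "a \<in> A" "b \<in> A" "inv a \<otimes> b \<in> L" for a b
  proof -
    have "inv a \<otimes> c \<in> L \<longleftrightarrow> inv b \<otimes> c \<in> L" if "c \<in> A" for c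
    proof -
      have c: "a \<in> carrier G" "b \<in> carrier G" "c \<in> carrier G" using \<open>a \<in> A\<close> \<open>b \<in> A\<close> that by auto
      have "inv (inv a \<otimes> b) \<in> L" using \<open>inv a \<otimes> b \<in> L\<close> by blast
      moreover have "inv (inv a \<otimes> b) \<otimes> (inv a \<otimes> c) = inv b \<otimes> c"
        "(inv a \<otimes> b) \<otimes> (inv b \<otimes> c) = inv a \<otimes> c" using c by (simp_all add: inv_mult_group m_assoc)
      ultimately show ?thesis using \<open>inv a \<otimes> b \<in> L\<close> L.m_closed by metis
    qed
    then have "(\<lambda>c. c \<in> A \<and> inv a \<otimes> c \<in> L) = (\<lambda>c. c \<in> A \<and> inv b \<otimes> c \<in> L)" by blast
    then show ?thesis unfolding r_def by simp
  qed
  define D where "D = discrete_topology (r ` A)"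
  have topA: "topspace (subtopology T A) = A" using A.subset by (auto simp: topspace_eq_carrier)
  have topK: "topspace (subtopology T K) = K" using A.subset by (auto simp: topspace_eq_carrier K_def)
  \<comment> \<open>\<open>r\<close> is constant on the traces on \<open>A\<close> of the open left
    cosets of \<open>L\<close>, hence continuous into a discrete space.\<close>
  have rc: "continuous_map (subtopology T A) D r"
    unfolding continuous_map_def
  proof (intro conjI allI impI)
    show "r \<in> topspace (subtopology T A) \<rightarrow> topspace D" using topA by (auto simp: D_def)
    fix U :: "'a set"
    show "openin (subtopology T A) {x \<in> topspace (subtopology T A). r x \<in> U}"
      unfolding topA
    proof (subst openin_subopen, intro ballI)
      fix a assume "a \<in> {x \<in> A. r x \<in> U}"
      then have a: "a \<in> A" "r a \<in> U" "a \<in> carrier G" by auto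
      define P where "P = {y \<in> carrier G. inv a \<otimes> y \<in> L} \<inter> A"
      have "openin T {y \<in> carrier G. inv a \<otimes> y \<in> L}"
        using L(2) a by (intro openin_preimage continuous_map_group_intros) auto
      then have "openin (subtopology T A) P"
        unfolding P_def openin_subtopology by blast
      moreover have "a \<in> P" using a by (simp add: P_def)
      moreover have "P \<subseteq> {x \<in> A. r x \<in> U}"
      proof
        fix y assume "y \<in> P"
        then have "y \<in> A" "inv a \<otimes> y \<in> L" by (simp_all add: P_def)
        with r_eq[OF a(1) this] a(2) show "y \<in> {x \<in> A. r x \<in> U}" by simp
      qed
      ultimately show "\<exists>P. openin (subtopology T A) P \<and> a \<in> P \<and> P \<subseteq> {x \<in> A. r x \<in> U}" by blast
    qed
  qed
  have "r ` A \<subseteq> carrier G" using r(1) A.subset by blast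
  then have DT: "continuous_map D T id" by (auto simp: D_def topspace_eq_carrier)
  have idA: "continuous_map (subtopology T A) T (\<lambda>a. a)"
    using continuous_map_from_subtopology[OF continuous_map_id] by (simp add: id_def)
  have rT: "continuous_map (subtopology T A) T r"
    using continuous_map_compose[OF rc DT] by simp
  have K: "inv (r a) \<otimes> a \<in> K" if a: "a \<in> A" for a
  proof -
    have "inv (inv a \<otimes> r a) \<in> L" using r[OF a] by blast
    moreover have "inv (inv a \<otimes> r a) = inv (r a) \<otimes> a" using r[OF a] a by (simp add: inv_mult_group)
    ultimately show ?thesis using r(1)[OF a] a by (simp add: K_def)
  qed
  have "homeomorphic_maps (subtopology T A) (prod_topology (subtopology T K) D)
      (\<lambda>a. (inv (r a) \<otimes> a, r a)) (\<lambda>(k, b). b \<otimes> k)"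
    unfolding homeomorphic_maps_def
  proof (intro conjI ballI)
    have "continuous_map (subtopology T A) T (\<lambda>a. inv (r a) \<otimes> a)"
      using rT idA by (intro continuous_map_mult continuous_map_inv)
    then have "continuous_map (subtopology T A) (subtopology T K) (\<lambda>a. inv (r a) \<otimes> a)"
      using K topA by (auto simp: continuous_map_in_subtopology)
    then show "continuous_map (subtopology T A) (prod_topology (subtopology T K) D) (\<lambda>a. (inv (r a) \<otimes> a, r a))"
      using rc by (simp add: continuous_map_paired)
    have "continuous_map (prod_topology (subtopology T K) D) T (\<lambda>p. snd p \<otimes> fst p)"
    proof (rule continuous_map_mult)
      show "continuous_map (prod_topology (subtopology T K) D) T snd"
        using continuous_map_compose[OF continuous_map_snd DT] by simp
      show "continuous_map (prod_topology (subtopology T K) D) T fst"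
        using continuous_map_fst[of "subtopology T K" D] by (simp add: continuous_map_in_subtopology)
    qed
    moreover have "snd p \<otimes> fst p \<in> A" if "p \<in> topspace (prod_topology (subtopology T K) D)" for p
    proof -
      have "p \<in> K \<times> r ` A" using that topK by (simp add: D_def)
      then have "fst p \<in> A" "snd p \<in> r ` A" unfolding K_def by (auto simp only: mem_Times_iff Int_iff)
      then obtain a where "a \<in> A" "snd p = r a" "fst p \<in> A" by blast
      then show ?thesis using r(1)[of a] by simp
    qed
    ultimately have "continuous_map (prod_topology (subtopology T K) D) (subtopology T A) (\<lambda>p. snd p \<otimes> fst p)"
      by (simp add: continuous_map_into_subtopology Pi_iff)
    then show "continuous_map (prod_topology (subtopology T K) D) (subtopology T A) (\<lambda>(k, b). b \<otimes> k)"
      by (simp add: case_prod_beta')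
    fix a assume "a \<in> topspace (subtopology T A)"
    then have "a \<in> A" using topA by simp
    then show "(case (inv (r a) \<otimes> a, r a) of (k, b) \<Rightarrow> b \<otimes> k) = a" using r by simp
  next
    fix p assume "p \<in> topspace (prod_topology (subtopology T K) D)"
    then obtain k a where p: "p = (k, r a)" "k \<in> A" "k \<in> L" "a \<in> A"
      using topK by (auto simp: D_def K_def)
    have ra: "r (r a \<otimes> k) = r a"
    proof -
      have "r (r a) = r a" using r_eq[of a "r a"] r[OF p(4)] p(4) by simp
      moreover have "inv (r a) \<otimes> (r a \<otimes> k) \<in> L" using p r by simp
      ultimately show ?thesis using r_eq[of "r a" "r a \<otimes> k"] p r by simp
    qed
    show "(inv (r (case p of (k, b) \<Rightarrow> b \<otimes> k)) \<otimes> (case p of (k, b) \<Rightarrow> b \<otimes> k), r (case p of (k, b) \<Rightarrow> b \<otimes> k)) = p"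
      using p r ra by simp
  qed
  then have "prod_topology (subtopology T K) D homeomorphic_space subtopology T A"
    using homeomorphic_space_sym unfolding homeomorphic_space_def by blast
  moreover have "metrizable_space D" by (simp add: D_def metrizable_space_discrete_topology)
  ultimately show ?thesis
    using Dieudonne_complete_space_homeomorphic Dieudonne_complete_space_prod_metrizable[OF KD] by blast
qed

text \<open>Points outside \<open>A\<close> are separated from \<open>K\<close> by the assumption on
  \<open>A\<close>. For \<open>x\<close> in \<open>A\<close> but not in \<open>K\<close>, write
  \<open>K = W \<inter> A\<close> with \<open>W\<close> open: the translate of \<open>W\<close> by
  \<open>x\<close> misses \<open>K\<close>, since a common point would put \<open>x\<close> into
  \<open>K\<close>.\<close>

lemma gdelta_closedin_open_subgroup_of:
  assumes A: "subgroup A G" "gdelta_closedin T A"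
    and K: "subgroup K G" "K \<subseteq> A" "openin (subtopology T A) K"
  shows "gdelta_closedin T K"
  unfolding gdelta_closedin_iff
proof (intro conjI ballI)
  interpret A: subgroup A G by (rule A)
  interpret K: subgroup K G by (rule K)
  show "K \<subseteq> topspace T" using K.subset by (simp add: topspace_eq_carrier)
  obtain W where W: "openin T W" "K = W \<inter> A" using K(3) unfolding openin_subtopology by blast
  fix x assume x: "x \<in> topspace T - K"
  show "\<exists>Q. gdelta_in T Q \<and> x \<in> Q \<and> Q \<inter> K = {}"
  proof (cases "x \<in> A")
    case False
    then show ?thesis using x A(2) K(2) unfolding gdelta_closedin_iff by blast
  next
    case True
    then have xc: "x \<in> carrier G" by auto
    have "openin T {y \<in> carrier G. inv x \<otimes> y \<in> W}"
      using W xc by (intro openin_preimage continuous_map_group_intros) auto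
    moreover have "x \<in> {y \<in> carrier G. inv x \<otimes> y \<in> W}" using xc W K.one_closed by auto
    moreover have "{y \<in> carrier G. inv x \<otimes> y \<in> W} \<inter> K = {}"
    proof (rule equals0I)
      fix y assume "y \<in> {y \<in> carrier G. inv x \<otimes> y \<in> W} \<inter> K"
      then have y: "y \<in> K" "inv x \<otimes> y \<in> W" "y \<in> A" "y \<in> carrier G" using K(2) by auto
      then have "inv x \<otimes> y \<in> K" using W(2) True by simp
      then have "y \<otimes> inv (inv x \<otimes> y) \<in> K" using y(1) by blast
      then show False using x xc y(4) by (simp add: inv_mult_group)
    qed
    ultimately show ?thesis using open_imp_gdelta_in by blast
  qed
qed

text \<open>By density, some \<open>a\<close> in \<open>A\<close> moves \<open>x\<close> to a point
  \<open>inv a \<otimes> x\<close> of \<open>W\<close>, where \<open>W \<inter> A = K\<close>. A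
  G-delta set that separates this point from \<open>K\<close> misses all of \<open>A\<close> once it
  is cut down to \<open>W\<close>, and translating back separates \<open>x\<close> from
  \<open>A\<close>.\<close>

lemma gdelta_closedin_if_open_subgroup:
  assumes A: "subgroup A G" "T closure_of A = carrier G"
    and K: "subgroup K G" "openin (subtopology T A) K" "gdelta_closedin T K"
  shows "gdelta_closedin T A"
  unfolding gdelta_closedin_iff
proof (intro conjI ballI)
  interpret A: subgroup A G by (rule A)
  interpret K: subgroup K G by (rule K)
  show "A \<subseteq> topspace T" using A.subset by (simp add: topspace_eq_carrier)
  obtain W where W: "openin T W" "K = W \<inter> A" using K(2) unfolding openin_subtopology by blast
  fix x assume "x \<in> topspace T - A"
  then have x: "x \<in> carrier G" "x \<notin> A" by (auto simp: topspace_eq_carrier)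
  have "openin T {y \<in> carrier G. inv y \<otimes> x \<in> W}"
    using W x by (intro openin_preimage continuous_map_group_intros) auto
  moreover have "x \<in> {y \<in> carrier G. inv y \<otimes> x \<in> W}" using x W K.one_closed by auto
  moreover have "x \<in> T closure_of A" using A x by simp
  ultimately obtain a where "a \<in> A" "a \<in> {y \<in> carrier G. inv y \<otimes> x \<in> W}"
    unfolding in_closure_of by meson
  then have a: "a \<in> A" "a \<in> carrier G" "inv a \<otimes> x \<in> W" by auto
  have "inv a \<otimes> x \<notin> A"
  proof
    assume "inv a \<otimes> x \<in> A"
    then have "a \<otimes> (inv a \<otimes> x) \<in> A" using a(1) by blast
    then show False using x a by simp
  qed
  then have "inv a \<otimes> x \<in> topspace T - K" using W(2) a x by (simp add: topspace_eq_carrier)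
  then obtain Q where Q: "gdelta_in T Q" "inv a \<otimes> x \<in> Q" "Q \<inter> K = {}"
    using K(3) unfolding gdelta_closedin_iff by blast
  have "gdelta_in T {y \<in> carrier G. inv a \<otimes> y \<in> Q \<inter> W}"
  proof (intro gdelta_in_preimage continuous_map_group_intros)
    show "gdelta_in T (Q \<inter> W)" using Q(1) open_imp_gdelta_in[OF W(1)] by (rule gdelta_in_Int)
  qed (use a in auto)
  moreover have "x \<in> {y \<in> carrier G. inv a \<otimes> y \<in> Q \<inter> W}" using x Q a by simp
  moreover have "{y \<in> carrier G. inv a \<otimes> y \<in> Q \<inter> W} \<inter> A = {}"
  proof (rule equals0I)
    fix y assume "y \<in> {y \<in> carrier G. inv a \<otimes> y \<in> Q \<inter> W} \<inter> A"
    then have "inv a \<otimes> y \<in> Q \<inter> W" "inv a \<otimes> y \<in> A" using a(1) by auto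
    then show False using Q(3) W(2) by blast
  qed
  ultimately show "\<exists>Q. gdelta_in T Q \<and> x \<in> Q \<and> Q \<inter> A = {}" by blast
qed

end

section \<open>The equivalences\<close>

theorem theorem2p22:
  fixes G :: "('a, 'm) monoid_scheme" and TG :: "'a topology"
    and H :: "('b, 'n) monoid_scheme" and TH :: "'b topology"
    and \<iota> :: "'a \<Rightarrow> 'b"
  assumes "locally_precompact_group G TG"
    and "group_completion G TG H TH \<iota>"
  shows
    "(Dieudonne_complete_space TG \<longleftrightarrow>
        locally_Dieudonne_complete_space TG) \<and>
     (Dieudonne_complete_space TG \<longleftrightarrow>
        locally_realcompact_space TG) \<and>
     (Dieudonne_complete_space TG \<longleftrightarrow>
        gdelta_closedin TH (\<iota> ` carrier G)) \<and>
     (Dieudonne_complete_space TG \<longleftrightarrow>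
        (\<forall>K. open_subgroup G TG K \<longrightarrow> gdelta_closedin TH (\<iota> ` K))) \<and>
     (Dieudonne_complete_space TG \<longleftrightarrow>
        (\<exists>K. open_subgroup G TG K \<and> gdelta_closedin TH (\<iota> ` K))) \<and>
     (Dieudonne_complete_space TG \<longleftrightarrow>
        (\<forall>K. open_subgroup G TG K \<and> omega_precompact_in G TG K \<longrightarrow>
             realcompact_space (subtopology TG K))) \<and>
     (Dieudonne_complete_space TG \<longleftrightarrow>
        (\<exists>K. open_subgroup G TG K \<and> realcompact_space (subtopology TG K))) \<and>
     (Dieudonne_complete_space TG \<longleftrightarrow>
        (\<exists>K. open_subgroup G TG K \<and> Dieudonne_complete_space (subtopology TG K)))"
proof -

  \<comment> \<open>The group as a dense subgroup of its completion\<close>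
  interpret G: topological_group G TG
    using assms(1) by (simp add: locally_precompact_group_def)
  interpret H: topological_group H TH
    using assms(2) by (simp add: group_completion_def)
  have lc: "locally_compact_space TH" and \<iota>: "\<iota> \<in> hom G H" and emb: "embedding_map TG TH \<iota>"
    and dense: "TH closure_of (\<iota> ` carrier G) = carrier H"
    using assms(2) by (auto simp: group_completion_def)
  interpret \<iota>: group_hom G H \<iota> by unfold_locales (rule \<iota>)
  define A where "A = \<iota> ` carrier G"
  have subA: "subgroup A H" unfolding A_def by (rule \<iota>.img_is_subgroup)
  have img: "subgroup (\<iota> ` K) H" "\<iota> ` K \<subseteq> A" if "subgroup K G" for K
    using \<iota>.subgroup_img_is_subgroup[OF that] subgroup.subset[OF that] by (auto simp: A_def)
  have hA: "homeomorphic_map TG (subtopology TH A) \<iota>"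
    using emb by (simp add: embedding_map_def A_def G.topspace_eq_carrier)
  have inj: "inj_on \<iota> (carrier G)"
    using homeomorphic_imp_injective_map[OF hA] by (simp add: G.topspace_eq_carrier)
  have hK: "subtopology TG K homeomorphic_space subtopology TH (\<iota> ` K)" if "K \<subseteq> carrier G" for K
  proof -
    have "homeomorphic_map (subtopology TG K) (subtopology (subtopology TH A) (\<iota> ` K)) \<iota>"
    proof (rule homeomorphic_map_subtopologies[OF hA])
      have "\<iota> ` K \<subseteq> A" using that by (auto simp: A_def)
      moreover have "A \<subseteq> topspace TH" using subgroup.subset[OF subA] by (simp add: H.topspace_eq_carrier)
      ultimately show "\<iota> ` (topspace TG \<inter> K) = topspace (subtopology TH A) \<inter> \<iota> ` K"
        using that by (simp add: G.topspace_eq_carrier Int_absorb1 Int_absorb2)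
    qed
    moreover have "A \<inter> \<iota> ` K = \<iota> ` K" using that by (auto simp: A_def)
    ultimately show ?thesis
      by (simp add: subtopology_subtopology homeomorphic_map_imp_homeomorphic_space)
  qed
  have hG: "subtopology TH A homeomorphic_space TG"
    using hA homeomorphic_map_imp_homeomorphic_space homeomorphic_space_sym by blast
  have openA: "openin (subtopology TH A) (\<iota> ` U)" if "openin TG U" for U
    using homeomorphic_map_openness[OF hA, of U] openin_subset[OF that] that by blast
  have contI: "continuous_map TG TH \<iota>"
    using homeomorphic_imp_continuous_map[OF hA] by (simp add: continuous_map_in_subtopology)
  let ?i = "Dieudonne_complete_space TG"
  let ?iv = "gdelta_closedin TH A"
  \<comment> \<open>A single Dieudonne complete set around the identity suffices. It will be the
    closure of a neighborhood in the local case and an open subgroup in the other.\<close>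
  have near_one: ?iv
    if U: "openin TG U" "\<one>\<^bsub>G\<^esub> \<in> U" "U \<subseteq> B" "B \<subseteq> carrier G"
      and B: "Dieudonne_complete_space (subtopology TG B)" for U B
  proof -
    obtain W where W: "openin TH W" "\<iota> ` U = W \<inter> A"
      using openA[OF U(1)] unfolding openin_subtopology by blast
    show ?thesis
    proof (rule H.gdelta_closedin_if_Dieudonne_complete_nhd[OF lc subA _ W(1)])
      show "TH closure_of A = carrier H" using dense by (simp add: A_def)
      have "\<iota> \<one>\<^bsub>G\<^esub> \<in> W" using U(2) W(2) by blast
      then show "\<one>\<^bsub>H\<^esub> \<in> W" by simp
      show "A \<inter> W \<subseteq> \<iota> ` B" using W(2) U(3) by blast
      show "\<iota> ` B \<subseteq> A" using U(4) by (auto simp: A_def)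
      show "Dieudonne_complete_space (subtopology TH (\<iota> ` B))"
        using Dieudonne_complete_space_homeomorphic[OF B hK[OF U(4)]] .
    qed
  qed

  \<comment> \<open>Global, local and G-delta conditions on the whole group\<close>
  have i_ii: "locally_Dieudonne_complete_space TG" if ?i
    unfolding locally_Dieudonne_complete_space_def
    using that by (auto intro!: exI[of _ "topspace TG"])
  have ii_iv: ?iv if ii: "locally_Dieudonne_complete_space TG"
  proof -
    have "\<one>\<^bsub>G\<^esub> \<in> topspace TG" by (simp add: G.topspace_eq_carrier)
    then obtain U where U: "openin TG U" "\<one>\<^bsub>G\<^esub> \<in> U"
      "Dieudonne_complete_space (subtopology TG (TG closure_of U))"
      using ii unfolding locally_Dieudonne_complete_space_def by blast
    show ?thesis
    proof (rule near_one[OF U(1,2) _ _ U(3)])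
      show "U \<subseteq> TG closure_of U" by (rule closure_of_subset[OF openin_subset[OF U(1)]])
      show "TG closure_of U \<subseteq> carrier G" using closure_of_subset_topspace[of TG U] by (simp add: G.topspace_eq_carrier)
    qed
  qed
  have iv_i: ?i if ?iv
    using H.Dieudonne_complete_gdelta_closed_subgroup[OF lc subA that] hG
    by (rule Dieudonne_complete_space_homeomorphic)
  have iii_ii: "locally_Dieudonne_complete_space TG" if "locally_realcompact_space TG"
    using that realcompact_imp_Dieudonne_complete_space
    unfolding locally_realcompact_space_def locally_Dieudonne_complete_space_def by blast

  \<comment> \<open>Passage between the group and its open subgroups\<close>
  have whole: "open_subgroup G TG (carrier G)"
    using G.subgroup_self openin_topspace[of TG] by (simp add: open_subgroup_def G.topspace_eq_carrier)
  have iv_v: "gdelta_closedin TH (\<iota> ` K)" if ?iv "open_subgroup G TG K" for K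
    using that H.gdelta_closedin_open_subgroup_of[OF subA] img openA by (simp add: open_subgroup_def)
  have vi_iv: ?iv if "open_subgroup G TG K" "gdelta_closedin TH (\<iota> ` K)" for K
  proof (rule H.gdelta_closedin_if_open_subgroup[OF subA _ _ _ that(2)])
    show "TH closure_of A = carrier H" using dense by (simp add: A_def)
    show "subgroup (\<iota> ` K) H" "openin (subtopology TH A) (\<iota> ` K)"
      using that(1) img openA by (simp_all add: open_subgroup_def)
  qed

  \<comment> \<open>Omega-precompact open subgroups\<close>
  obtain L \<C> where L: "subgroup L H" "openin TH L" "countable \<C>" "\<forall>C\<in>\<C>. compactin TH C" "L = \<Union>\<C>"
    by (rule H.sigma_compact_open_subgroup[OF lc])
  interpret L: subgroup L H by (rule L)
  have iv_vii: "realcompact_space (subtopology TG K)"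
    if ?iv and K: "open_subgroup G TG K" "omega_precompact_in G TG K" for K
  proof -
    have KG: "K \<subseteq> carrier G" using K(1) subgroup.subset[of K G] by (simp add: open_subgroup_def)
    \<comment> \<open>Omega-precompactness, applied to the preimage of \<open>L\<close>, covers the
      image of \<open>K\<close> by countably many left cosets of \<open>L\<close>.\<close>
    define U where "U = {g \<in> carrier G. \<iota> g \<in> L}"
    have "openin TG U"
      using openin_continuous_map_preimage[OF contI L(2)] by (simp add: U_def G.topspace_eq_carrier)
    then have "U \<in> nhds_one G TG" by (simp add: nhds_one_def U_def)
    with K(2) have "\<exists>S. countable S \<and> S \<subseteq> K \<and> K \<subseteq> (S <#>\<^bsub>G\<^esub> U) \<inter> (U <#>\<^bsub>G\<^esub> S)"
      by (simp add: omega_precompact_in_def)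
    then obtain S where S: "countable S" "S \<subseteq> K" "K \<subseteq> S <#>\<^bsub>G\<^esub> U" by blast
    have "realcompact_space (subtopology TH (\<iota> ` K))"
    proof (rule H.realcompact_in_sigma_compact_cosets[OF lc L])
      show "countable (\<iota> ` S)" using S(1) by blast
      show "\<iota> ` S \<subseteq> carrier H" using S(2) KG by auto
      show "gdelta_closedin TH (\<iota> ` K)" by (rule iv_v[OF that(1) K(1)])
      show "\<forall>k\<in>\<iota> ` K. \<exists>s\<in>\<iota> ` S. inv\<^bsub>H\<^esub> s \<otimes>\<^bsub>H\<^esub> k \<in> L"
      proof
        fix k assume "k \<in> \<iota> ` K"
        then obtain s u where su: "s \<in> S" "u \<in> U" "k = \<iota> (s \<otimes>\<^bsub>G\<^esub> u)"
          using S(3) unfolding set_mult_def by blast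
        then have "s \<in> carrier G" "u \<in> carrier G" using S KG by (auto simp: U_def)
        then have "inv\<^bsub>H\<^esub> (\<iota> s) \<otimes>\<^bsub>H\<^esub> k = \<iota> u" using su(3) by simp
        then have "inv\<^bsub>H\<^esub> (\<iota> s) \<otimes>\<^bsub>H\<^esub> k \<in> L" using su(2) by (simp add: U_def)
        then show "\<exists>s\<in>\<iota> ` S. inv\<^bsub>H\<^esub> s \<otimes>\<^bsub>H\<^esub> k \<in> L" using su(1) by blast
      qed
    qed
    then show ?thesis
      using hK[OF KG] homeomorphic_space_sym realcompact_space_homeomorphic by blast
  qed
  \<comment> \<open>The preimage of the sigma-compact subgroup \<open>L\<close> serves. Its
    existence keeps the condition on omega-precompact open subgroups from holding vacuously and
    turns it into the existence of a realcompact open subgroup.\<close>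
  have ex_omega: "\<exists>K. open_subgroup G TG K \<and> omega_precompact_in G TG K"
  proof (intro exI conjI)
    define K where "K = {g \<in> carrier G. \<iota> g \<in> L}"
    have KG: "K \<subseteq> carrier G" by (auto simp: K_def)
    have Ksub: "subgroup K G"
      by unfold_locales (auto simp: K_def)
    have KL: "\<iota> ` K \<subseteq> \<Union>\<C>" using L(5) by (auto simp: K_def)
    have "openin TG K"
      using openin_continuous_map_preimage[OF contI L(2)] by (simp add: K_def G.topspace_eq_carrier)
    with Ksub show "open_subgroup G TG K" by (simp add: open_subgroup_def)
    interpret K: subgroup K G by (rule Ksub)
    show "omega_precompact_in G TG K"
      unfolding omega_precompact_in_def
    proof (intro conjI ballI KG)
      fix U assume "U \<in> nhds_one G TG"
      then have U: "openin TG U" "\<one>\<^bsub>G\<^esub> \<in> U" by (auto simp: nhds_one_def)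
      obtain U' where U': "openin TG U'" "\<one>\<^bsub>G\<^esub> \<in> U'" "U' \<subseteq> U" "\<forall>x\<in>U'. inv\<^bsub>G\<^esub> x \<in> U'"
        "\<forall>x\<in>U'. \<forall>y\<in>U'. x \<otimes>\<^bsub>G\<^esub> y \<in> U"
        by (rule G.nhd_one_mult[OF U])
      obtain W where W: "openin TH W" "\<iota> ` U' = W \<inter> A"
        using openA[OF U'(1)] unfolding openin_subtopology by blast
      have "\<iota> \<one>\<^bsub>G\<^esub> \<in> W" using U'(2) W(2) by blast
      then have "\<one>\<^bsub>H\<^esub> \<in> W" by simp
      then obtain S' where S': "countable S'" "S' \<subseteq> \<iota> ` K"
          "\<forall>k\<in>\<iota> ` K. \<exists>s\<in>S'. inv\<^bsub>H\<^esub> s \<otimes>\<^bsub>H\<^esub> k \<in> W"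
        by (rule H.countable_net_of_sigma_compact[OF L(3,4) KL W(1)])
      obtain S where S: "countable S" "S \<subseteq> K" "S' = \<iota> ` S"
        using S'(1,2) by (meson countable_subset_image)
      have net: "\<exists>s\<in>S. inv\<^bsub>G\<^esub> s \<otimes>\<^bsub>G\<^esub> k \<in> U'" if k: "k \<in> K" for k
      proof -
        obtain s where s: "s \<in> S" "inv\<^bsub>H\<^esub> (\<iota> s) \<otimes>\<^bsub>H\<^esub> \<iota> k \<in> W"
          using S'(3) S(3) k by blast
        have sk: "s \<in> carrier G" "k \<in> carrier G" using s S(2) KG k by auto
        then have eq: "\<iota> (inv\<^bsub>G\<^esub> s \<otimes>\<^bsub>G\<^esub> k) = inv\<^bsub>H\<^esub> (\<iota> s) \<otimes>\<^bsub>H\<^esub> \<iota> k" by simp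
        moreover have "\<iota> (inv\<^bsub>G\<^esub> s \<otimes>\<^bsub>G\<^esub> k) \<in> A" using sk unfolding A_def by blast
        ultimately have "\<iota> (inv\<^bsub>G\<^esub> s \<otimes>\<^bsub>G\<^esub> k) \<in> \<iota> ` U'" using s W(2) by simp
        then have "inv\<^bsub>G\<^esub> s \<otimes>\<^bsub>G\<^esub> k \<in> U'"
          using inj_on_image_mem_iff[OF inj _ G.openin_subset_carrier[OF U'(1)], THEN iffD1] sk
            G.inv_closed G.m_closed by blast
        then show ?thesis using s by blast
      qed
      \<comment> \<open>The net \<open>S\<close> gives the cover with \<open>U\<close> on the right.
        Applying it to the inverse of \<open>k\<close> and inverting gives
        \<open>k \<otimes> s\<close> in \<open>U\<close>, so the inverses of \<open>S\<close> give
        the cover with \<open>U\<close> on the left.\<close>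
      define R where "R = S \<union> (\<lambda>s. inv\<^bsub>G\<^esub> s) ` S"
      have "K \<subseteq> R <#>\<^bsub>G\<^esub> U"
      proof
        fix k assume k: "k \<in> K"
        then obtain s where s: "s \<in> S" "inv\<^bsub>G\<^esub> s \<otimes>\<^bsub>G\<^esub> k \<in> U'" using net by blast
        then have "k = s \<otimes>\<^bsub>G\<^esub> (inv\<^bsub>G\<^esub> s \<otimes>\<^bsub>G\<^esub> k)" using S(2) KG k by (simp add: subset_iff)
        moreover have "s \<in> R" "inv\<^bsub>G\<^esub> s \<otimes>\<^bsub>G\<^esub> k \<in> U" using s U'(3) by (auto simp: R_def)
        ultimately show "k \<in> R <#>\<^bsub>G\<^esub> U" unfolding set_mult_def by blast
      qed
      moreover have "K \<subseteq> U <#>\<^bsub>G\<^esub> R"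
      proof
        fix k assume k: "k \<in> K"
        then obtain s where s: "s \<in> S" "inv\<^bsub>G\<^esub> s \<otimes>\<^bsub>G\<^esub> inv\<^bsub>G\<^esub> k \<in> U'" using net K.m_inv_closed by blast
        have sk: "s \<in> carrier G" "k \<in> carrier G" using s S(2) KG k by auto
        have "inv\<^bsub>G\<^esub> (inv\<^bsub>G\<^esub> s \<otimes>\<^bsub>G\<^esub> inv\<^bsub>G\<^esub> k) \<in> U" using s U'(3,4) by blast
        then have "k \<otimes>\<^bsub>G\<^esub> s \<in> U" using sk by (simp add: G.inv_mult_group)
        moreover have "inv\<^bsub>G\<^esub> s \<in> R" using s by (auto simp: R_def)
        moreover have "k = (k \<otimes>\<^bsub>G\<^esub> s) \<otimes>\<^bsub>G\<^esub> inv\<^bsub>G\<^esub> s" using sk by simp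
        ultimately show "k \<in> U <#>\<^bsub>G\<^esub> R" unfolding set_mult_def by blast
      qed
      moreover have "countable R" "R \<subseteq> K" using S by (auto simp: R_def)
      ultimately show "\<exists>S. countable S \<and> S \<subseteq> K \<and> K \<subseteq> (S <#>\<^bsub>G\<^esub> U) \<inter> (U <#>\<^bsub>G\<^esub> S)" by blast
    qed
  qed

  \<comment> \<open>Consequences of a complete open subgroup\<close>
  have viii_iii: "locally_realcompact_space TG"
    if K: "open_subgroup G TG K" "realcompact_space (subtopology TG K)" for K
    unfolding locally_realcompact_space_def
  proof
    fix x assume "x \<in> topspace TG"
    then have "x \<in> carrier G" by (simp add: G.topspace_eq_carrier)
    moreover have "subgroup K G" "openin TG K" using K(1) by (auto simp: open_subgroup_def)
    ultimately obtain U where "openin TG U" "x \<in> U" "TG closure_of U = U"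
        "subtopology TG K homeomorphic_space subtopology TG U"
      by (rule_tac G.open_subgroup_coset)
    then show "\<exists>U. openin TG U \<and> x \<in> U \<and> realcompact_space (subtopology TG (TG closure_of U))"
      using realcompact_space_homeomorphic[OF K(2)] by metis
  qed
  have ix_iv: ?iv if K: "open_subgroup G TG K" "Dieudonne_complete_space (subtopology TG K)" for K
  proof (rule near_one[OF _ _ order_refl _ K(2)])
    show "openin TG K" "\<one>\<^bsub>G\<^esub> \<in> K" "K \<subseteq> carrier G"
      using K(1) subgroup.one_closed[of K G] subgroup.subset[of K G]
      by (simp_all add: open_subgroup_def)
  qed
  have iv: "?iv \<longleftrightarrow> gdelta_closedin TH (\<iota> ` carrier G)" by (simp add: A_def)
  have viii_i: ?i if "open_subgroup G TG K" "realcompact_space (subtopology TG K)" for K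
    using ix_iv[OF that(1) realcompact_imp_Dieudonne_complete_space[OF that(2)]] by (rule iv_i)
  have i_iv: ?iv if ?i using that by (intro ii_iv i_ii)
  have i_viii: "\<exists>K. open_subgroup G TG K \<and> realcompact_space (subtopology TG K)" if ?i
    using ex_omega iv_vii[OF i_iv[OF that]] by blast
  show ?thesis
  \<comment> \<open>The core is the cycle \<open>i_ii\<close>, \<open>ii_iv\<close>,
    \<open>iv_i\<close>. The conditions on open subgroups return to it through \<open>vi_iv\<close>
    and \<open>ix_iv\<close>, and local realcompactness through \<open>iii_ii\<close>.\<close>
  proof (intro conjI iffI)
    show "locally_Dieudonne_complete_space TG" if ?i using that by (rule i_ii)
    show ?i if "locally_Dieudonne_complete_space TG" using that by (intro iv_i ii_iv)
    show "locally_realcompact_space TG" if ?i using i_viii[OF that] viii_iii by blast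
    show ?i if "locally_realcompact_space TG" using that by (intro iv_i ii_iv iii_ii)
    show "gdelta_closedin TH (\<iota> ` carrier G)" if ?i using i_iv[OF that] iv by simp
    show ?i if "gdelta_closedin TH (\<iota> ` carrier G)" using that iv iv_i by simp
    show "\<forall>K. open_subgroup G TG K \<longrightarrow> gdelta_closedin TH (\<iota> ` K)" if ?i
      using iv_v[OF i_iv[OF that]] by blast
    show ?i if "\<forall>K. open_subgroup G TG K \<longrightarrow> gdelta_closedin TH (\<iota> ` K)"
      using that whole iv iv_i by blast
    show "\<exists>K. open_subgroup G TG K \<and> gdelta_closedin TH (\<iota> ` K)" if ?i
      using i_iv[OF that] iv whole by blast
    show ?i if "\<exists>K. open_subgroup G TG K \<and> gdelta_closedin TH (\<iota> ` K)"
      using that vi_iv iv_i by blast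
    show "\<forall>K. open_subgroup G TG K \<and> omega_precompact_in G TG K \<longrightarrow> realcompact_space (subtopology TG K)" if ?i
      using iv_vii[OF i_iv[OF that]] by blast
    show ?i if "\<forall>K. open_subgroup G TG K \<and> omega_precompact_in G TG K \<longrightarrow> realcompact_space (subtopology TG K)"
      using that ex_omega viii_i by blast
    show "\<exists>K. open_subgroup G TG K \<and> realcompact_space (subtopology TG K)" if ?i
      using that by (rule i_viii)
    show ?i if "\<exists>K. open_subgroup G TG K \<and> realcompact_space (subtopology TG K)"
      using that viii_i by blast
    show "\<exists>K. open_subgroup G TG K \<and> Dieudonne_complete_space (subtopology TG K)" if ?i
      using i_viii[OF that] realcompact_imp_Dieudonne_complete_space by blast
    show ?i if "\<exists>K. open_subgroup G TG K \<and> Dieudonne_complete_space (subtopology TG K)"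
      using that ix_iv iv_i by blast
  qed
qed

end
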